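(* Let $\mathcal{C}$ be a path category. If $\mathcal{C}$ has weak homotopy $\Pi$-types, then the path category $\mathrm{Ex}(\mathcal{C})$ has homotopy exponentials (for every pair of objects) and $\mathrm{Hex}(\mathcal{C})$ has ordinary exponentials (for every pair of objects).
   Context: A path category is a category $\mathcal{C}$ with two classes of maps, fibrations and weak equivalences (maps in both classes are called acyclic fibrations), such that: (1) fibrations are closed under composition; (2) the pullback of a fibration along any map exists and is a fibration; (3) the pullback of an acyclic fibration along any map is an acyclic fibration; (4) 2-out-of-6: if $f:A\to B$, $g:B\to C$, $h:C\to D$ and $gf$, $hg$ are weak equivalences, then so are $f,g,h,hgf$; (5) isomorphisms are acyclic fibrations and every acyclic fibration has a section; (6) every object $B$ has a path object, i.e. a factorisation of the diagonal $B \to B\times B$ as a weak equivalence $r: B \to PB$ followed by a fibration $(s,t): PB \to B \times B$; (7) there is a terminal object $1$ and every map $X \to 1$ is a fibration. In a path category, $f,g: Y \to X$ are homotopic, $f \simeq g$, if for some path object $PX$ there is $h: Y \to PX$ with $sh = f$, $th = g$; this is a congruence independent of the choice of path object. In a path category, a homotopy exponential of objects $X$ and $Y$ is an object $X^Y$ with a map $\mathrm{ev}: X^Y\times Y\to X$ such that for any $h: A\times Y\to X$ there is a map $H: A\to X^Y$, unique up to homotopy, with $\mathrm{ev}(H\times 1)\simeq h$. For an object $A$, $\mathcal{C}(A)$ is the full subcategory of $\mathcal{C}/A$ on the fibrations with codomain $A$, with fibrations and weak equivalences as in $\mathcal{C}$; it is again a path category. If $p: X \to I$ is a fibration and $f,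 g: Y \to X$ satisfy $pf = pg$, then $f$ and $g$ are fibrewise homotopic over $I$ if for a path object $(s,t): P_I(X) \to X \times_I X$ of $X$ in $\mathcal{C}(I)$ there is $h: Y \to P_I(X)$ with $sh = f$ and $th = g$ (here $pf=pg$ need not be a fibration). $\mathcal{C}$ has weak homotopy $\Pi$-types if for any two fibrations $f: X\to J$ and $\alpha: J\to I$ there is an object $\Pi_\alpha X$ of $\mathcal{C}(I)$ (a fibration $\Pi_\alpha X\to I$) together with a map $\mathrm{ev}: \alpha^*\Pi_\alpha X\to X$ over $J$ such that: for any maps $g: Y\to I$ and $m: \alpha^*Y\to X$ with $m$ over $J$, there is a map $n: Y\to\Pi_\alpha X$ over $I$ such that $m$ and $\mathrm{ev}\circ\alpha^*n: \alpha^*Y\to X$ are fibrewise homotopic over $J$. Here $\alpha^*$ denotes pullback along $\alpha$. A homotopy equivalence relation on $X$ in $\mathcal{C}$ is a fibration $p=(p_1,p_2): R \to X \times X$ such that there exist: $\rho: X \to R$ with $p\rho = \Delta_X$; $\sigma: R \to R$ with $p_1\sigma = p_2$, $p_2\sigma = p_1$; and, for the pullback $R\times_X R$ of $p_2$ and $p_1$ with projections $q_1,q_2$ (so $p_2q_1 = p_1q_2$), a map $\tau: R\times_X R \to R$ with $p_1\tau = p_1q_1$ and $p_2\tau = p_2q_2$. $\mathrm{Hex}(\mathcal{C})$ has as objects the pairs $(X, \rho: R \to X\times X)$ with $\rho$ a homotopy equivalence relation in $\mathcal{C}$. A morphism $(X,\rho:R\to X\times X) \to (Y,\sigma: S\to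 Y\times Y)$ is an equivalence class of maps $f: X \to Y$ in $\mathcal{C}$ for which there is $\varphi: R \to S$ with $\sigma\varphi = (f\times f)\rho$; two such $f,g$ are identified if there is $H: X \to S$ with $\sigma H = (f,g)$. $\mathrm{Ex}(\mathcal{C})$ has the same objects as $\mathrm{Hex}(\mathcal{C})$; a morphism $(X,\rho:R\to X\times X) \to (Y,\sigma: S\to Y\times Y)$ is a map $f: X \to Y$ in $\mathcal{C}$ for which there exists $\varphi: R \to S$ with $\sigma\varphi = (f\times f)\rho$. For two such morphisms write $f \sim g$ if there is $H: X \to S$ with $\sigma H = (f,g)$. Write $\rho = (\rho_1,\rho_2)$ and $\sigma = (\sigma_1,\sigma_2)$. The morphism $f$ is a fibration in $\mathrm{Ex}(\mathcal{C})$ if (1) $f$ is a fibration in $\mathcal{C}$, and (2) for the pullback $X\times_Y S$ of $f$ and $\sigma_1$, with projections $p_1: X\times_Y S\to X$ and $p_2: X\times_Y S \to S$, there is a map $\nabla: X\times_Y S \to R$ in $\mathcal{C}$ with $\rho_1\nabla = p_1$ and $f\rho_2\nabla = \sigma_2p_2$. The morphism $f$ is a weak equivalence in $\mathrm{Ex}(\mathcal{C})$ if there is a morphism $g: (Y,S) \to (X,R)$ in $\mathrm{Ex}(\mathcal{C})$ with $fg \sim 1_Y$ and $gf \sim 1_X$. With these classes $\mathrm{Ex}(\mathcal{C})$ is a path category, and its homotopy relation is $\sim$. *)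

theory Defs
  imports Main
begin

section \<open>Categories\<close>

text \<open>
  A category is given by its objects, its arrows (with source and target) and a composition
  operation that is meaningful on composable arrows only; \<open>g \<cdot>\<^bsub>K\<^esub> f\<close> means \<open>f\<close> first, then \<open>g\<close>.
\<close>

record ('o, 'm) cat =
  obj :: "'o set"
  arr :: "'m set"
  src :: "'m \<Rightarrow> 'o"
  tgt :: "'m \<Rightarrow> 'o"
  ident :: "'o \<Rightarrow> 'm"
  cmp :: "'m \<Rightarrow> 'm \<Rightarrow> 'm"  (infixl "\<cdot>\<index>" 70)

definition hom :: "('o, 'm, 'x) cat_scheme \<Rightarrow> 'o \<Rightarrow> 'o \<Rightarrow> 'm set" where
  "hom K A B = {f \<in> arr K. src K f = A \<and> tgt K f = B}"

locale category =
  fixes K :: "('o, 'm, 'x) cat_scheme" (structure)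
  assumes src_obj: "f \<in> arr K \<Longrightarrow> src K f \<in> obj K"
    and tgt_obj: "f \<in> arr K \<Longrightarrow> tgt K f \<in> obj K"
    and ident_hom: "A \<in> obj K \<Longrightarrow> ident K A \<in> hom K A A"
    and cmp_hom: "f \<in> hom K A B \<Longrightarrow> g \<in> hom K B C \<Longrightarrow> g \<cdot> f \<in> hom K A C"
    and ident_left: "f \<in> hom K A B \<Longrightarrow> ident K B \<cdot> f = f"
    and ident_right: "f \<in> hom K A B \<Longrightarrow> f \<cdot> ident K A = f"
    and cmp_assoc: "f \<in> hom K A B \<Longrightarrow> g \<in> hom K B C \<Longrightarrow> h \<in> hom K C D \<Longrightarrow>
          h \<cdot> (g \<cdot> f) = (h \<cdot> g) \<cdot> f"

definition iso :: "('o, 'm, 'x) cat_scheme \<Rightarrow> 'm \<Rightarrow> bool" where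
  "iso K f \<longleftrightarrow> f \<in> arr K \<and>
     (\<exists>g \<in> hom K (tgt K f) (src K f).
        g \<cdot>\<^bsub>K\<^esub> f = ident K (src K f) \<and> f \<cdot>\<^bsub>K\<^esub> g = ident K (tgt K f))"

definition terminal :: "('o, 'm, 'x) cat_scheme \<Rightarrow> 'o \<Rightarrow> bool" where
  "terminal K T \<longleftrightarrow> T \<in> obj K \<and> (\<forall>X \<in> obj K. \<exists>!f. f \<in> hom K X T)"

definition product :: "('o, 'm, 'x) cat_scheme \<Rightarrow> 'o \<Rightarrow> 'o \<Rightarrow> 'o \<Rightarrow> 'm \<Rightarrow> 'm \<Rightarrow> bool" where
  "product K X Y P p q \<longleftrightarrow> p \<in> hom K P X \<and> q \<in> hom K P Y \<and>
     (\<forall>Z a b. a \<in> hom K Z X \<longrightarrow> b \<in> hom K Z Y \<longrightarrow>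
        (\<exists>!u. u \<in> hom K Z P \<and> p \<cdot>\<^bsub>K\<^esub> u = a \<and> q \<cdot>\<^bsub>K\<^esub> u = b))"

definition has_binary_products :: "('o, 'm, 'x) cat_scheme \<Rightarrow> bool" where
  "has_binary_products K \<longleftrightarrow> (\<forall>X \<in> obj K. \<forall>Y \<in> obj K. \<exists>P p q. product K X Y P p q)"

text \<open>
  In \<open>pullback K f g P p q\<close>, the projection \<open>p\<close> goes to the source of \<open>f\<close> and \<open>q\<close> to the source
  of \<open>g\<close>. Thus \<open>q\<close> is the pullback of \<open>f\<close> along \<open>g\<close>.
\<close>

definition pullback :: "('o, 'm, 'x) cat_scheme \<Rightarrow> 'm \<Rightarrow> 'm \<Rightarrow> 'o \<Rightarrow> 'm \<Rightarrow> 'm \<Rightarrow> bool" where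
  "pullback K f g P p q \<longleftrightarrow>
     f \<in> arr K \<and> g \<in> arr K \<and> tgt K f = tgt K g \<and>
     p \<in> hom K P (src K f) \<and> q \<in> hom K P (src K g) \<and> f \<cdot>\<^bsub>K\<^esub> p = g \<cdot>\<^bsub>K\<^esub> q \<and>
     (\<forall>Z a b. a \<in> hom K Z (src K f) \<longrightarrow> b \<in> hom K Z (src K g) \<longrightarrow> f \<cdot>\<^bsub>K\<^esub> a = g \<cdot>\<^bsub>K\<^esub> b \<longrightarrow>
        (\<exists>!u. u \<in> hom K Z P \<and> p \<cdot>\<^bsub>K\<^esub> u = a \<and> q \<cdot>\<^bsub>K\<^esub> u = b))"

text \<open>\<open>u = H \<times> 1 : A \<times> Y \<rightarrow> E \<times> Y\<close>, for product cones \<open>(Q, q1, q2)\<close> of \<open>A, Y\<close> and \<open>(P, p1, p2)\<close> of \<open>E, Y\<close>.\<close>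

definition is_times_id ::
    "('o, 'm, 'x) cat_scheme \<Rightarrow> 'o \<Rightarrow> 'm \<Rightarrow> 'm \<Rightarrow> 'o \<Rightarrow> 'm \<Rightarrow> 'm \<Rightarrow> 'm \<Rightarrow> 'm \<Rightarrow> bool" where
  "is_times_id K Q q1 q2 P p1 p2 H u \<longleftrightarrow>
     u \<in> hom K Q P \<and> p1 \<cdot>\<^bsub>K\<^esub> u = H \<cdot>\<^bsub>K\<^esub> q1 \<and> p2 \<cdot>\<^bsub>K\<^esub> u = q2"

definition exponential ::
    "('o, 'm, 'x) cat_scheme \<Rightarrow> 'o \<Rightarrow> 'o \<Rightarrow> 'o \<Rightarrow> 'o \<Rightarrow> 'm \<Rightarrow> 'm \<Rightarrow> 'm \<Rightarrow> bool" where
  "exponential K X Y E P p1 p2 ev \<longleftrightarrow>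
     E \<in> obj K \<and> product K E Y P p1 p2 \<and> ev \<in> hom K P X \<and>
     (\<forall>A \<in> obj K. \<forall>Q q1 q2 h. product K A Y Q q1 q2 \<longrightarrow> h \<in> hom K Q X \<longrightarrow>
        (\<exists>!H. H \<in> hom K A E \<and>
           (\<exists>u. is_times_id K Q q1 q2 P p1 p2 H u \<and> ev \<cdot>\<^bsub>K\<^esub> u = h)))"

text \<open>
  Existence of binary products is implicit in speaking of exponentials; it is stated so that the
  quantification over product cones above is never vacuous.
\<close>

definition has_exponentials :: "('o, 'm, 'x) cat_scheme \<Rightarrow> bool" where
  "has_exponentials K \<longleftrightarrow> has_binary_products K \<and>
     (\<forall>X \<in> obj K. \<forall>Y \<in> obj K. \<exists>E P p1 p2 ev. exponential K X Y E P p1 p2 ev)"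


section \<open>Path categories\<close>

record ('o, 'm) pcat = "('o, 'm) cat" +
  fib :: "'m set"
  weq :: "'m set"

text \<open>
  \<open>(a, b) : R \<rightarrow> X \<times> X\<close> is a fibration. As products are not chosen, a map into \<open>X \<times> X\<close> is always given
  by its two components. Since isomorphisms are fibrations, which product is used is immaterial.
\<close>

definition pair_fibration :: "('o, 'm, 'x) pcat_scheme \<Rightarrow> 'o \<Rightarrow> 'o \<Rightarrow> 'm \<Rightarrow> 'm \<Rightarrow> bool" where
  "pair_fibration K R X a b \<longleftrightarrow>
     (\<exists>Q q1 q2 u. product K X X Q q1 q2 \<and> u \<in> hom K R Q \<and> q1 \<cdot>\<^bsub>K\<^esub> u = a \<and> q2 \<cdot>\<^bsub>K\<^esub> u = b \<and>
        u \<in> fib K)"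

definition path_object ::
    "('o, 'm, 'x) pcat_scheme \<Rightarrow> 'o \<Rightarrow> 'o \<Rightarrow> 'm \<Rightarrow> 'm \<Rightarrow> 'm \<Rightarrow> bool" where
  "path_object K B P r s t \<longleftrightarrow>
     r \<in> hom K B P \<and> r \<in> weq K \<and> s \<in> hom K P B \<and> t \<in> hom K P B \<and>
     s \<cdot>\<^bsub>K\<^esub> r = ident K B \<and> t \<cdot>\<^bsub>K\<^esub> r = ident K B \<and> pair_fibration K P B s t"

locale path_category = category K for K :: "('o, 'm, 'x) pcat_scheme" (structure) +
  assumes fib_arr: "fib K \<subseteq> arr K"
    and weq_arr: "weq K \<subseteq> arr K"
    and fib_cmp: "f \<in> fib K \<Longrightarrow> g \<in> fib K \<Longrightarrow> tgt K f = src K g \<Longrightarrow> g \<cdot> f \<in> fib K"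
    and fib_pullback_ex: "f \<in> fib K \<Longrightarrow> g \<in> arr K \<Longrightarrow> tgt K f = tgt K g \<Longrightarrow>
          \<exists>P p q. pullback K f g P p q"
    and fib_pullback: "f \<in> fib K \<Longrightarrow> pullback K f g P p q \<Longrightarrow> q \<in> fib K"
    and acyclic_pullback: "f \<in> fib K \<inter> weq K \<Longrightarrow> pullback K f g P p q \<Longrightarrow> q \<in> fib K \<inter> weq K"
    and two_out_of_six: "f \<in> hom K A B \<Longrightarrow> g \<in> hom K B C \<Longrightarrow> h \<in> hom K C D \<Longrightarrow>
          g \<cdot> f \<in> weq K \<Longrightarrow> h \<cdot> g \<in> weq K \<Longrightarrow>
          f \<in> weq K \<and> g \<in> weq K \<and> h \<in> weq K \<and> h \<cdot> (g \<cdot> f) \<in> weq K"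
    and iso_acyclic: "iso K f \<Longrightarrow> f \<in> fib K \<inter> weq K"
    and acyclic_section: "f \<in> fib K \<inter> weq K \<Longrightarrow>
          \<exists>e \<in> hom K (tgt K f) (src K f). f \<cdot> e = ident K (tgt K f)"
    and path_object_ex: "B \<in> obj K \<Longrightarrow> \<exists>P r s t. path_object K B P r s t"
    and terminal_ex: "\<exists>T. terminal K T \<and> (\<forall>X \<in> obj K. hom K X T \<subseteq> fib K)"

definition homotopic :: "('o, 'm, 'x) pcat_scheme \<Rightarrow> 'm \<Rightarrow> 'm \<Rightarrow> bool" where
  "homotopic K f g \<longleftrightarrow> f \<in> arr K \<and> g \<in> arr K \<and> src K f = src K g \<and> tgt K f = tgt K g \<and>
     (\<exists>P r s t. path_object K (tgt K f) P r s t \<and>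
        (\<exists>h \<in> hom K (src K f) P. s \<cdot>\<^bsub>K\<^esub> h = f \<and> t \<cdot>\<^bsub>K\<^esub> h = g))"

definition homotopy_exponential ::
    "('o, 'm, 'x) pcat_scheme \<Rightarrow> 'o \<Rightarrow> 'o \<Rightarrow> 'o \<Rightarrow> 'o \<Rightarrow> 'm \<Rightarrow> 'm \<Rightarrow> 'm \<Rightarrow> bool" where
  "homotopy_exponential K X Y E P p1 p2 ev \<longleftrightarrow>
     E \<in> obj K \<and> product K E Y P p1 p2 \<and> ev \<in> hom K P X \<and>
     (\<forall>A \<in> obj K. \<forall>Q q1 q2 h. product K A Y Q q1 q2 \<longrightarrow> h \<in> hom K Q X \<longrightarrow>
        (let curry_of = (\<lambda>H. H \<in> hom K A E \<and>
               (\<exists>u. is_times_id K Q q1 q2 P p1 p2 H u \<and> homotopic K (ev \<cdot>\<^bsub>K\<^esub> u) h))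
         in (\<exists>H. curry_of H) \<and> (\<forall>H H'. curry_of H \<longrightarrow> curry_of H' \<longrightarrow> homotopic K H H')))"

definition has_homotopy_exponentials :: "('o, 'm, 'x) pcat_scheme \<Rightarrow> bool" where
  "has_homotopy_exponentials K \<longleftrightarrow> has_binary_products K \<and>
     (\<forall>X \<in> obj K. \<forall>Y \<in> obj K. \<exists>E P p1 p2 ev. homotopy_exponential K X Y E P p1 p2 ev)"


section \<open>Fibrations over a fixed base and weak homotopy \<open>\<Pi>\<close>-types\<close>

text \<open>An arrow of a derived category: an underlying map (or class of maps) with source and target.\<close>

datatype ('a, 'b) darr = Darr (dsrc: 'a) (umap: 'b) (dtgt: 'a)

definition over :: "('o, 'm) pcat \<Rightarrow> 'o \<Rightarrow> ('m, ('m, 'm) darr) pcat" where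
  "over K I =
     (let Ob = {p \<in> fib K. tgt K p = I};
          Ar = {Darr p u q | p u q. p \<in> Ob \<and> q \<in> Ob \<and> u \<in> hom K (src K p) (src K q) \<and>
                                    q \<cdot>\<^bsub>K\<^esub> u = p}
      in \<lparr> obj = Ob, arr = Ar, src = dsrc, tgt = dtgt,
           ident = (\<lambda>p. Darr p (ident K (src K p)) p),
           cmp = (\<lambda>g f. Darr (dsrc f) (umap g \<cdot>\<^bsub>K\<^esub> umap f) (dtgt g)),
           fib = {a \<in> Ar. umap a \<in> fib K},
           weq = {a \<in> Ar. umap a \<in> weq K} \<rparr>)"

text \<open>
  \<open>f\<close> and \<open>g\<close> are fibrewise homotopic with respect to the fibration \<open>p\<close>. The common composite
  \<open>p \<cdot> f = p \<cdot> g\<close> need not be a fibration, so \<open>f\<close>, \<open>g\<close> and the homotopy are maps of the ambient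
  category; only the path object lives over the base.
\<close>

definition fibrewise_homotopic :: "('o, 'm) pcat \<Rightarrow> 'm \<Rightarrow> 'm \<Rightarrow> 'm \<Rightarrow> bool" where
  "fibrewise_homotopic K p f g \<longleftrightarrow>
     (\<exists>Y. f \<in> hom K Y (src K p) \<and> g \<in> hom K Y (src K p) \<and> p \<cdot>\<^bsub>K\<^esub> f = p \<cdot>\<^bsub>K\<^esub> g \<and>
        (\<exists>P r s t. path_object (over K (tgt K p)) p P r s t \<and>
           (\<exists>h \<in> hom K Y (src K P). umap s \<cdot>\<^bsub>K\<^esub> h = f \<and> umap t \<cdot>\<^bsub>K\<^esub> h = g)))"

text \<open>
  The object \<open>\<Pi>\<^sub>\<alpha> X\<close> is the fibration \<open>\<pi>\<close>, \<open>(A, a1, a2)\<close> is \<open>\<alpha>\<^sup>* \<Pi>\<^sub>\<alpha> X\<close> with its projections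
  to \<open>J\<close> and to \<open>\<Pi>\<^sub>\<alpha> X\<close>, \<open>(B, b1, b2)\<close> is \<open>\<alpha>\<^sup>* Y\<close>, and \<open>u\<close> is \<open>\<alpha>\<^sup>* n\<close>.
\<close>

definition weak_homotopy_Pi ::
    "('o, 'm) pcat \<Rightarrow> 'm \<Rightarrow> 'm \<Rightarrow> 'm \<Rightarrow> 'o \<Rightarrow> 'm \<Rightarrow> 'm \<Rightarrow> 'm \<Rightarrow> bool" where
  "weak_homotopy_Pi K f \<alpha> \<pi> A a1 a2 ev \<longleftrightarrow>
     \<pi> \<in> fib K \<and> tgt K \<pi> = tgt K \<alpha> \<and> pullback K \<alpha> \<pi> A a1 a2 \<and>
     ev \<in> hom K A (src K f) \<and> f \<cdot>\<^bsub>K\<^esub> ev = a1 \<and>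
     (\<forall>g B b1 b2 m. g \<in> arr K \<longrightarrow> tgt K g = tgt K \<alpha> \<longrightarrow> pullback K \<alpha> g B b1 b2 \<longrightarrow>
        m \<in> hom K B (src K f) \<longrightarrow> f \<cdot>\<^bsub>K\<^esub> m = b1 \<longrightarrow>
        (\<exists>n u. n \<in> hom K (src K g) (src K \<pi>) \<and> \<pi> \<cdot>\<^bsub>K\<^esub> n = g \<and>
           u \<in> hom K B A \<and> a1 \<cdot>\<^bsub>K\<^esub> u = b1 \<and> a2 \<cdot>\<^bsub>K\<^esub> u = n \<cdot>\<^bsub>K\<^esub> b2 \<and>
           fibrewise_homotopic K f m (ev \<cdot>\<^bsub>K\<^esub> u)))"

definition has_weak_homotopy_Pi :: "('o, 'm) pcat \<Rightarrow> bool" where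
  "has_weak_homotopy_Pi K \<longleftrightarrow>
     (\<forall>f \<in> fib K. \<forall>\<alpha> \<in> fib K. tgt K f = src K \<alpha> \<longrightarrow>
        (\<exists>\<pi> A a1 a2 ev. weak_homotopy_Pi K f \<alpha> \<pi> A a1 a2 ev))"


section \<open>The exact completion and its homotopy category\<close>

text \<open>A pair \<open>(X, \<rho> : R \<rightarrow> X \<times> X)\<close>, where \<open>\<rho>\<close> is given by its two components \<open>R \<rightarrow> X\<close>.\<close>

record ('o, 'm) relobj =
  carr :: 'o
  rel :: 'o
  leg1 :: 'm
  leg2 :: 'm

definition hequiv_rel :: "('o, 'm) pcat \<Rightarrow> ('o, 'm) relobj \<Rightarrow> bool" where
  "hequiv_rel K A \<longleftrightarrow>
     (let X = carr A; R = rel A; p1 = leg1 A; p2 = leg2 A in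
      X \<in> obj K \<and> p1 \<in> hom K R X \<and> p2 \<in> hom K R X \<and> pair_fibration K R X p1 p2 \<and>
      (\<exists>\<rho> \<in> hom K X R. p1 \<cdot>\<^bsub>K\<^esub> \<rho> = ident K X \<and> p2 \<cdot>\<^bsub>K\<^esub> \<rho> = ident K X) \<and>
      (\<exists>\<sigma> \<in> hom K R R. p1 \<cdot>\<^bsub>K\<^esub> \<sigma> = p2 \<and> p2 \<cdot>\<^bsub>K\<^esub> \<sigma> = p1) \<and>
      (\<exists>Q q1 q2. pullback K p2 p1 Q q1 q2 \<and>
         (\<exists>\<tau> \<in> hom K Q R. p1 \<cdot>\<^bsub>K\<^esub> \<tau> = p1 \<cdot>\<^bsub>K\<^esub> q1 \<and> p2 \<cdot>\<^bsub>K\<^esub> \<tau> = p2 \<cdot>\<^bsub>K\<^esub> q2)))"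

definition ex_maps :: "('o, 'm) pcat \<Rightarrow> ('o, 'm) relobj \<Rightarrow> ('o, 'm) relobj \<Rightarrow> 'm set" where
  "ex_maps K A B = {f \<in> hom K (carr A) (carr B).
     \<exists>\<phi> \<in> hom K (rel A) (rel B).
       leg1 B \<cdot>\<^bsub>K\<^esub> \<phi> = f \<cdot>\<^bsub>K\<^esub> leg1 A \<and> leg2 B \<cdot>\<^bsub>K\<^esub> \<phi> = f \<cdot>\<^bsub>K\<^esub> leg2 A}"

definition ex_sim :: "('o, 'm) pcat \<Rightarrow> ('o, 'm) relobj \<Rightarrow> ('o, 'm) relobj \<Rightarrow> ('m \<times> 'm) set" where
  "ex_sim K A B = {(f, g). f \<in> ex_maps K A B \<and> g \<in> ex_maps K A B \<and>
     (\<exists>H \<in> hom K (carr A) (rel B). leg1 B \<cdot>\<^bsub>K\<^esub> H = f \<and> leg2 B \<cdot>\<^bsub>K\<^esub> H = g)}"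

definition ex_fibration :: "('o, 'm) pcat \<Rightarrow> ('o, 'm) relobj \<Rightarrow> ('o, 'm) relobj \<Rightarrow> 'm \<Rightarrow> bool" where
  "ex_fibration K A B f \<longleftrightarrow> f \<in> fib K \<and>
     (\<exists>Q p1 p2. pullback K f (leg1 B) Q p1 p2 \<and>
        (\<exists>d \<in> hom K Q (rel A). leg1 A \<cdot>\<^bsub>K\<^esub> d = p1 \<and> f \<cdot>\<^bsub>K\<^esub> (leg2 A \<cdot>\<^bsub>K\<^esub> d) = leg2 B \<cdot>\<^bsub>K\<^esub> p2))"

definition ex_weak_equivalence ::
    "('o, 'm) pcat \<Rightarrow> ('o, 'm) relobj \<Rightarrow> ('o, 'm) relobj \<Rightarrow> 'm \<Rightarrow> bool" where
  "ex_weak_equivalence K A B f \<longleftrightarrow>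
     (\<exists>g \<in> ex_maps K B A. (f \<cdot>\<^bsub>K\<^esub> g, ident K (carr B)) \<in> ex_sim K B B \<and>
                          (g \<cdot>\<^bsub>K\<^esub> f, ident K (carr A)) \<in> ex_sim K A A)"

definition Ex_cat ::
    "('o, 'm) pcat \<Rightarrow> (('o, 'm) relobj, (('o, 'm) relobj, 'm) darr) pcat" where
  "Ex_cat K =
     (let Ob = {A. hequiv_rel K A};
          Ar = {Darr A f B | A f B. A \<in> Ob \<and> B \<in> Ob \<and> f \<in> ex_maps K A B}
      in \<lparr> obj = Ob, arr = Ar, src = dsrc, tgt = dtgt,
           ident = (\<lambda>A. Darr A (ident K (carr A)) A),
           cmp = (\<lambda>g f. Darr (dsrc f) (umap g \<cdot>\<^bsub>K\<^esub> umap f) (dtgt g)),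
           fib = {a \<in> Ar. ex_fibration K (dsrc a) (dtgt a) (umap a)},
           weq = {a \<in> Ar. ex_weak_equivalence K (dsrc a) (dtgt a) (umap a)} \<rparr>)"

definition Hex_cat ::
    "('o, 'm) pcat \<Rightarrow> (('o, 'm) relobj, (('o, 'm) relobj, 'm set) darr) cat" where
  "Hex_cat K =
     (let Ob = {A. hequiv_rel K A} in
      \<lparr> obj = Ob,
        arr = {Darr A F B | A F B. A \<in> Ob \<and> B \<in> Ob \<and> F \<in> ex_maps K A B // ex_sim K A B},
        src = dsrc, tgt = dtgt,
        ident = (\<lambda>A. Darr A (ex_sim K A A `` {ident K (carr A)}) A),
        cmp = (\<lambda>G F. Darr (dsrc F)
                 (\<Union>g \<in> umap G. \<Union>f \<in> umap F. ex_sim K (dsrc F) (dtgt G) `` {g \<cdot>\<^bsub>K\<^esub> f})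
                 (dtgt G)) \<rparr>)"

end

theory Submission
  imports Defs
begin

text \<open>
  A homotopy equivalence relation on \<open>X\<close> is an equivalence relation on the generalised elements
  \<open>Z \<rightarrow> X\<close>, stable under precomposition and represented by a fibration, and predicates represented by
  fibrations are closed under substitution, conjunction and, by weak homotopy \<open>\<Pi>\<close>-types along
  projections, under \<open>\<forall>\<close>. Let \<open>W\<close> be a weak exponential of the underlying objects of \<open>X\<close> and \<open>Y\<close>, where
  currying is only correct up to homotopy. The carrier \<open>E\<close> of the exponential is the fibration over
  \<open>W\<close> representing ``for all related \<open>y, y'\<close>, \<open>w(y)\<close> and \<open>w(y')\<close> are related'', and two elements of \<open>E\<close>
  are related if their values at all \<open>y\<close> are. Uniqueness of currying up to relatedness then holds by
  construction, and homotopic maps are related, so the defect of \<open>W\<close> is invisible in the exact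
  completion. The homotopy relation there is relatedness, because the relation on \<open>Y\<close> itself
  carries a path object of \<open>Y\<close>; in the homotopy category the universal property becomes strict.
\<close>

section \<open>Composition and product cones\<close>

text \<open>Weak \<Pi>-types are used in two ways, with different costs. As a quantifier they are
  exact: a predicate only asks whether a lift exists, and the map obtained by currying lies over the
  given element by an equation, not by a homotopy. As function spaces they are defective: a currying
  is not unique, and evaluating it returns the original map only up to fibrewise homotopy. Absorbing
  this defect is the one task that calls on the weak equivalences of the base category. It rests on
  the fact that a fibration through which some weak equivalence factors has a section, and this is
  why the mapping path factorisation is derived. An element of \<open>W\<close> is a bare map of
  carriers that need not respect the relations. The domain of the fibration that cuts
  \<open>W\<close> down contains proofs of compatibility as data, but the relation on
  \<open>E\<close> compares values only, so different proofs are identified. A compatible map into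
  \<open>W\<close> factors strictly through this fibration, hence passing from \<open>W\<close> to
  \<open>E\<close> adds no further error to evaluation.\<close>

context category
begin

lemma cmp_arr [simp]:
  assumes "f \<in> arr K" "g \<in> arr K" "tgt K f = src K g"
  shows "g \<cdot> f \<in> arr K" "src K (g \<cdot> f) = src K f" "tgt K (g \<cdot> f) = tgt K g"
  using cmp_hom[of f "src K f" "src K g" g "tgt K g"] assms by (auto simp: hom_def)

lemma cmp_assoc_right [simp]:
  "f \<in> arr K \<Longrightarrow> g \<in> arr K \<Longrightarrow> h \<in> arr K \<Longrightarrow> tgt K f = src K g \<Longrightarrow> tgt K g = src K h \<Longrightarrow>
    (h \<cdot> g) \<cdot> f = h \<cdot> (g \<cdot> f)"
  using cmp_assoc[of f "src K f" "src K g" g "src K h" h "tgt K h"] by (auto simp: hom_def)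

text \<open>Simplification nests composites to the right, so the left-hand side of an equation
  \<open>g \<cdot> f = e\<close> no longer occurs in \<open>g \<cdot> (f \<cdot> x)\<close>. This
  form of the equation applies to such composites.\<close>

lemma cmp_eq_reassoc:
  "g \<cdot> f = e \<Longrightarrow> f \<in> arr K \<Longrightarrow> g \<in> arr K \<Longrightarrow> x \<in> arr K \<Longrightarrow> tgt K x = src K f \<Longrightarrow> tgt K f = src K g \<Longrightarrow>
    g \<cdot> (f \<cdot> x) = e \<cdot> x"
  using cmp_assoc_right[of x f g] by simp

lemma ident_arr [simp]:
  assumes "A \<in> obj K"
  shows "ident K A \<in> arr K" "src K (ident K A) = A" "tgt K (ident K A) = A"
  using ident_hom[OF assms] by (auto simp: hom_def)

lemma ident_cmp [simp]:
  "f \<in> arr K \<Longrightarrow> tgt K f = A \<Longrightarrow> ident K A \<cdot> f = f"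
  "f \<in> arr K \<Longrightarrow> src K f = A \<Longrightarrow> f \<cdot> ident K A = f"
  using ident_left[of f] ident_right[of f] by (auto simp: hom_def)

lemma hom_obj: "f \<in> hom K A B \<Longrightarrow> A \<in> obj K" "f \<in> hom K A B \<Longrightarrow> B \<in> obj K"
  using src_obj tgt_obj by (auto simp: hom_def)

section \<open>Product cones and independence of their choice\<close>

lemma product_universal:
  assumes "product K X Y P p q" "a \<in> hom K Z X" "b \<in> hom K Z Y"
  shows "\<exists>!u. u \<in> hom K Z P \<and> p \<cdot> u = a \<and> q \<cdot> u = b"
  using assms unfolding product_def by blast

lemma product_mediate:
  assumes "product K X Y P p q" "a \<in> hom K Z X" "b \<in> hom K Z Y"
  obtains u where "u \<in> hom K Z P" "p \<cdot> u = a" "q \<cdot> u = b"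
  using assms unfolding product_def by blast

lemma product_joint_mono:
  assumes pr: "product K X Y P p q" and u: "u \<in> hom K Z P" and v: "v \<in> hom K Z P"
    and eq: "p \<cdot> u = p \<cdot> v" "q \<cdot> u = q \<cdot> v"
  shows "u = v"
proof -
  have "p \<cdot> u \<in> hom K Z X" "q \<cdot> u \<in> hom K Z Y"
    using pr u cmp_hom unfolding product_def by auto
  then have "\<exists>!w. w \<in> hom K Z P \<and> p \<cdot> w = p \<cdot> u \<and> q \<cdot> w = q \<cdot> u"
    using pr unfolding product_def by blast
  then show ?thesis using u v eq by metis
qed

lemma product_comparison:
  assumes P: "product K X Y P p q" and P': "product K X Y P' p' q'"
  obtains j j' where "j \<in> hom K P P'" "j' \<in> hom K P' P" "j \<cdot> j' = ident K P'" "j' \<cdot> j = ident K P"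
    "p' \<cdot> j = p" "q' \<cdot> j = q" "p \<cdot> j' = p'" "q \<cdot> j' = q'"
proof -
  have h: "p \<in> hom K P X" "q \<in> hom K P Y" "p' \<in> hom K P' X" "q' \<in> hom K P' Y"
    using P P' by (auto simp: product_def)
  obtain j where j: "j \<in> hom K P P'" "p' \<cdot> j = p" "q' \<cdot> j = q"
    using product_mediate[OF P' h(1,2)] .
  obtain j' where j': "j' \<in> hom K P' P" "p \<cdot> j' = p'" "q \<cdot> j' = q'"
    using product_mediate[OF P h(3,4)] .
  have o: "P \<in> obj K" "P' \<in> obj K" using h hom_obj by blast+
  have "j \<cdot> j' = ident K P'"
    by (rule product_joint_mono[OF P', of _ P'])
      (use h j j' o in \<open>auto simp: hom_def cmp_eq_reassoc[OF j(2)] cmp_eq_reassoc[OF j(3)]\<close>)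
  moreover have "j' \<cdot> j = ident K P"
    by (rule product_joint_mono[OF P, of _ P])
      (use h j j' o in \<open>auto simp: hom_def cmp_eq_reassoc[OF j'(2)] cmp_eq_reassoc[OF j'(3)]\<close>)
  ultimately show thesis using that j j' by blast
qed

text \<open>The universal properties quantify over every product cone of \<open>A\<close> and
  \<open>Y\<close>, while the constructions supply one. Transporting \<open>h\<close> along the
  comparison isomorphism, as \<open>h' = h \<cdot> j'\<close>, leaves the set of curryings
  unchanged. The relation \<open>sim\<close> must be stable under precomposition; it is equality for
  exponentials and homotopy for homotopy exponentials.\<close>

lemma times_id_change_cone:
  assumes Q: "product K A Y Q q1 q2" and Q': "product K A Y Q' q1' q2'"
    and P: "product K E Y P p1 p2" and ev: "ev \<in> hom K P X" and h: "h \<in> hom K Q X"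
    and sim: "\<And>f g k. sim f g \<Longrightarrow> f \<in> arr K \<Longrightarrow> g \<in> arr K \<Longrightarrow> k \<in> arr K \<Longrightarrow> tgt K k = src K f \<Longrightarrow>
      src K g = src K f \<Longrightarrow> sim (f \<cdot> k) (g \<cdot> k)"
  shows "\<exists>h' \<in> hom K Q' X. \<forall>H \<in> hom K A E.
    (\<exists>u. is_times_id K Q' q1' q2' P p1 p2 H u \<and> sim (ev \<cdot> u) h') \<longleftrightarrow>
    (\<exists>u. is_times_id K Q q1 q2 P p1 p2 H u \<and> sim (ev \<cdot> u) h)"
proof -
  obtain j j' where j: "j \<in> hom K Q Q'" "j' \<in> hom K Q' Q" "j \<cdot> j' = ident K Q'"
      "j' \<cdot> j = ident K Q" "q1' \<cdot> j = q1" "q2' \<cdot> j = q2" "q1 \<cdot> j' = q1'" "q2 \<cdot> j' = q2'"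
    using product_comparison[OF Q Q'] .
  have t: "q1 \<in> hom K Q A" "q2 \<in> hom K Q Y" "q1' \<in> hom K Q' A" "q2' \<in> hom K Q' Y"
      "p1 \<in> hom K P E" "p2 \<in> hom K P Y"
    using Q Q' P by (auto simp: product_def)
  have h': "h \<cdot> j' \<in> hom K Q' X" using h j cmp_hom by blast
  have "(\<exists>u. is_times_id K Q' q1' q2' P p1 p2 H u \<and> sim (ev \<cdot> u) (h \<cdot> j')) \<longleftrightarrow>
      (\<exists>u. is_times_id K Q q1 q2 P p1 p2 H u \<and> sim (ev \<cdot> u) h)" if H: "H \<in> hom K A E" for H
  proof
    assume "\<exists>u. is_times_id K Q' q1' q2' P p1 p2 H u \<and> sim (ev \<cdot> u) (h \<cdot> j')"
    then obtain u where u: "u \<in> hom K Q' P" "p1 \<cdot> u = H \<cdot> q1'" "p2 \<cdot> u = q2'"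
      and s: "sim (ev \<cdot> u) (h \<cdot> j')" by (auto simp: is_times_id_def)
    have "is_times_id K Q q1 q2 P p1 p2 H (u \<cdot> j)"
      using u t j(1,5,6) H cmp_eq_reassoc[OF u(2), of j] cmp_eq_reassoc[OF u(3), of j]
      by (simp add: is_times_id_def hom_def)
    moreover have "sim (ev \<cdot> (u \<cdot> j)) h"
      using sim[OF s, of j] u ev h j(1,2,4) by (simp add: hom_def)
    ultimately show "\<exists>u. is_times_id K Q q1 q2 P p1 p2 H u \<and> sim (ev \<cdot> u) h" by blast
  next
    assume "\<exists>u. is_times_id K Q q1 q2 P p1 p2 H u \<and> sim (ev \<cdot> u) h"
    then obtain u where u: "u \<in> hom K Q P" "p1 \<cdot> u = H \<cdot> q1" "p2 \<cdot> u = q2"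
      and s: "sim (ev \<cdot> u) h" by (auto simp: is_times_id_def)
    have "is_times_id K Q' q1' q2' P p1 p2 H (u \<cdot> j')"
      using u t j(2,7,8) H cmp_eq_reassoc[OF u(2), of j'] cmp_eq_reassoc[OF u(3), of j']
      by (simp add: is_times_id_def hom_def)
    moreover have "sim (ev \<cdot> (u \<cdot> j')) (h \<cdot> j')"
      using sim[OF s, of j'] u ev h j(2) by (simp add: hom_def)
    ultimately show "\<exists>u. is_times_id K Q' q1' q2' P p1 p2 H u \<and> sim (ev \<cdot> u) (h \<cdot> j')" by blast
  qed
  with h' show ?thesis by blast
qed

lemma exponentialI:
  assumes E: "E \<in> obj K" and P: "product K E Y P p1 p2" and ev: "ev \<in> hom K P X"
    and univ: "\<And>A. A \<in> obj K \<Longrightarrow> \<exists>Q q1 q2. product K A Y Q q1 q2 \<and> (\<forall>h \<in> hom K Q X.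
      \<exists>!H. H \<in> hom K A E \<and> (\<exists>u. is_times_id K Q q1 q2 P p1 p2 H u \<and> ev \<cdot> u = h))"
  shows "exponential K X Y E P p1 p2 ev"
  unfolding exponential_def
proof (intro conjI E P ev ballI allI impI)
  define curry where "curry A Q q1 q2 h H \<longleftrightarrow> H \<in> hom K A E \<and>
    (\<exists>u. is_times_id K Q q1 q2 P p1 p2 H u \<and> ev \<cdot> u = h)" for A Q q1 q2 h H
  fix A Q q1 q2 h
  assume A: "A \<in> obj K" and Q: "product K A Y Q q1 q2" and h: "h \<in> hom K Q X"
  obtain Q' q1' q2' where Q': "product K A Y Q' q1' q2'"
    and u: "\<forall>h \<in> hom K Q' X. \<exists>!H. curry A Q' q1' q2' h H"
    using univ[OF A, folded curry_def] by blast
  have "\<exists>h' \<in> hom K Q' X. \<forall>H \<in> hom K A E.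
      (\<exists>u. is_times_id K Q' q1' q2' P p1 p2 H u \<and> ev \<cdot> u = h') \<longleftrightarrow>
      (\<exists>u. is_times_id K Q q1 q2 P p1 p2 H u \<and> ev \<cdot> u = h)"
    by (rule times_id_change_cone[OF Q Q' P ev h, where sim = "(=)"]) (rule arg_cong)
  then obtain h' where h': "h' \<in> hom K Q' X"
    and "\<forall>H. curry A Q' q1' q2' h' H \<longleftrightarrow> curry A Q q1 q2 h H"
    unfolding curry_def by blast
  then have "curry A Q q1 q2 h = curry A Q' q1' q2' h'" by (simp add: fun_eq_iff)
  with bspec[OF u h'] have "\<exists>!H. curry A Q q1 q2 h H" by simp
  then show "\<exists>!H. H \<in> hom K A E \<and> (\<exists>u. is_times_id K Q q1 q2 P p1 p2 H u \<and> ev \<cdot> u = h)"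
    unfolding curry_def .
qed

end

text \<open>This supplies the stability under precomposition asked of \<open>sim\<close>. It is
  applied to \<open>Ex_cat K\<close>, for which the category axioms are what is derived here, hence
  the hypothesis \<open>category K\<close>.\<close>

lemma homotopic_precompose:
  fixes K :: "('o, 'm, 'x) pcat_scheme" (structure)
  assumes "category K" and hom: "homotopic K f g" and k: "k \<in> arr K" "tgt K k = src K f"
  shows "homotopic K (f \<cdot> k) (g \<cdot> k)"
proof -
  interpret category K by fact
  obtain P r s t h where P: "path_object K (tgt K f) P r s t"
    and h: "h \<in> hom K (src K f) P" "s \<cdot> h = f" "t \<cdot> h = g"
    and fg: "f \<in> arr K" "g \<in> arr K" "src K f = src K g" "tgt K f = tgt K g"
    using hom by (auto simp: homotopic_def)
  have "s \<in> hom K P (tgt K f)" "t \<in> hom K P (tgt K f)" using P by (auto simp: path_object_def)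
  then have "h \<cdot> k \<in> hom K (src K (f \<cdot> k)) P" "s \<cdot> (h \<cdot> k) = f \<cdot> k" "t \<cdot> (h \<cdot> k) = g \<cdot> k"
    using h k fg cmp_eq_reassoc[OF h(2), of k] cmp_eq_reassoc[OF h(3), of k]
    by (auto simp: hom_def)
  with P have "\<exists>P r s t. path_object K (tgt K (f \<cdot> k)) P r s t \<and>
      (\<exists>h \<in> hom K (src K (f \<cdot> k)) P. s \<cdot> h = f \<cdot> k \<and> t \<cdot> h = g \<cdot> k)"
    using fg k by (metis cmp_arr(3))
  then show ?thesis using fg k unfolding homotopic_def by simp
qed

lemma homotopy_exponentialI:
  fixes K :: "('o, 'm, 'x) pcat_scheme" (structure)
  assumes "category K"
    and E: "E \<in> obj K" and P: "product K E Y P p1 p2" and ev: "ev \<in> hom K P X"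
    and univ: "\<And>A. A \<in> obj K \<Longrightarrow> \<exists>Q q1 q2. product K A Y Q q1 q2 \<and> (\<forall>h \<in> hom K Q X.
      (\<exists>H. H \<in> hom K A E \<and> (\<exists>u. is_times_id K Q q1 q2 P p1 p2 H u \<and> homotopic K (ev \<cdot> u) h)) \<and>
      (\<forall>H H'. H \<in> hom K A E \<and> (\<exists>u. is_times_id K Q q1 q2 P p1 p2 H u \<and> homotopic K (ev \<cdot> u) h) \<longrightarrow>
        H' \<in> hom K A E \<and> (\<exists>u. is_times_id K Q q1 q2 P p1 p2 H' u \<and> homotopic K (ev \<cdot> u) h) \<longrightarrow>
        homotopic K H H'))"
  shows "homotopy_exponential K X Y E P p1 p2 ev"
  unfolding homotopy_exponential_def Let_def
proof (intro E P ev conjI ballI allI impI)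
  interpret category K by fact
  define curry where "curry A Q q1 q2 h H \<longleftrightarrow> H \<in> hom K A E \<and>
    (\<exists>u. is_times_id K Q q1 q2 P p1 p2 H u \<and> homotopic K (ev \<cdot> u) h)" for A Q q1 q2 h H
  fix A Q q1 q2 h
  assume A: "A \<in> obj K" and Q: "product K A Y Q q1 q2" and h: "h \<in> hom K Q X"
  obtain Q' q1' q2' where Q': "product K A Y Q' q1' q2'"
    and u: "\<forall>h \<in> hom K Q' X. (\<exists>H. curry A Q' q1' q2' h H) \<and>
      (\<forall>H H'. curry A Q' q1' q2' h H \<longrightarrow> curry A Q' q1' q2' h H' \<longrightarrow> homotopic K H H')"
    using univ[OF A, folded curry_def] by blast
  have "\<exists>h' \<in> hom K Q' X. \<forall>H \<in> hom K A E.
      (\<exists>u. is_times_id K Q' q1' q2' P p1 p2 H u \<and> homotopic K (ev \<cdot> u) h') \<longleftrightarrow>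
      (\<exists>u. is_times_id K Q q1 q2 P p1 p2 H u \<and> homotopic K (ev \<cdot> u) h)"
    by (rule times_id_change_cone[OF Q Q' P ev h, where sim = "homotopic K"])
      (rule homotopic_precompose[OF assms(1)])
  then obtain h' where h': "h' \<in> hom K Q' X"
    and iff': "\<And>H. curry A Q q1 q2 h H \<longleftrightarrow> curry A Q' q1' q2' h' H"
    unfolding curry_def by blast
  note u = bspec[OF u h', folded iff', unfolded curry_def]
  show "\<exists>H. H \<in> hom K A E \<and> (\<exists>u. is_times_id K Q q1 q2 P p1 p2 H u \<and> homotopic K (ev \<cdot> u) h)"
    by (rule conjunct1[OF u])
  show "homotopic K H H'"
    if "H \<in> hom K A E \<and> (\<exists>u. is_times_id K Q q1 q2 P p1 p2 H u \<and> homotopic K (ev \<cdot> u) h)"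
      "H' \<in> hom K A E \<and> (\<exists>u. is_times_id K Q q1 q2 P p1 p2 H' u \<and> homotopic K (ev \<cdot> u) h)" for H H'
    using conjunct2[OF u] that by (elim allE impE)
qed


section \<open>Weak equivalences and fibrations\<close>

context path_category
begin

section \<open>Chosen binary products and pairing of maps\<close>

definition product_cone :: "'o \<Rightarrow> 'o \<Rightarrow> 'o \<times> 'm \<times> 'm" where
  "product_cone X Y = (SOME (P, p, q). product K X Y P p q \<and> p \<in> fib K \<and> q \<in> fib K)"

definition prd :: "'o \<Rightarrow> 'o \<Rightarrow> 'o" where "prd X Y = fst (product_cone X Y)"
definition pr1 :: "'o \<Rightarrow> 'o \<Rightarrow> 'm" where "pr1 X Y = fst (snd (product_cone X Y))"
definition pr2 :: "'o \<Rightarrow> 'o \<Rightarrow> 'm" where "pr2 X Y = snd (snd (product_cone X Y))"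

definition tup :: "'m \<Rightarrow> 'm \<Rightarrow> 'm" where
  "tup a b = (THE u. u \<in> hom K (src K a) (prd (tgt K a) (tgt K b)) \<and>
     pr1 (tgt K a) (tgt K b) \<cdot> u = a \<and> pr2 (tgt K a) (tgt K b) \<cdot> u = b)"

text \<open>This is \<open>z \<times> 1\<close> on chosen products. As an abbreviation it is open to
  the simplification rules for \<open>tup\<close>, so that such maps are compared
  componentwise.\<close>

abbreviation times_id :: "'o \<Rightarrow> 'm \<Rightarrow> 'm" where
  "times_id Y z \<equiv> tup (z \<cdot> pr1 (src K z) Y) (pr2 (src K z) Y)"

lemma fibD: "f \<in> fib K \<Longrightarrow> f \<in> arr K" using fib_arr by blast

text \<open>A product is the pullback of \<open>X \<rightarrow> 1\<close> and
  \<open>Y \<rightarrow> 1\<close>. Both of these are fibrations, so each projection is the pullback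
  of a fibration; for the first projection the square is read with its sides exchanged.\<close>

lemma prd_product:
  assumes X: "X \<in> obj K" and Y: "Y \<in> obj K"
  shows "product K X Y (prd X Y) (pr1 X Y) (pr2 X Y)" "pr1 X Y \<in> fib K" "pr2 X Y \<in> fib K"
proof -
  obtain T where T: "terminal K T" and Tf: "\<forall>X \<in> obj K. hom K X T \<subseteq> fib K"
    using terminal_ex by blast
  obtain x y where x: "x \<in> hom K X T" and y: "y \<in> hom K Y T"
    using T X Y unfolding terminal_def by metis
  have xf: "x \<in> fib K" "y \<in> fib K" using x y Tf X Y by (meson subsetD)+
  obtain P p q where pb: "pullback K x y P p q"
    using fib_pullback_ex[OF xf(1), of y] x y by (auto simp: hom_def)
  have "product K X Y P p q"
    unfolding product_def
  proof (intro conjI allI impI)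
    show "p \<in> hom K P X" "q \<in> hom K P Y" using pb x y by (auto simp: pullback_def hom_def)
    fix Z a b assume a: "a \<in> hom K Z X" and b: "b \<in> hom K Z Y"
    have "x \<cdot> a \<in> hom K Z T" "y \<cdot> b \<in> hom K Z T" using a b x y cmp_hom by blast+
    moreover have "Z \<in> obj K" using a hom_obj by blast
    ultimately have "x \<cdot> a = y \<cdot> b" using T by (metis terminal_def)
    moreover have "a \<in> hom K Z (src K x)" "b \<in> hom K Z (src K y)"
      using a b x y by (auto simp: hom_def)
    ultimately show "\<exists>!u. u \<in> hom K Z P \<and> p \<cdot> u = a \<and> q \<cdot> u = b"
      using pb unfolding pullback_def by blast
  qed
  moreover have "q \<in> fib K" using fib_pullback[OF xf(1) pb] .
  moreover have "p \<in> fib K"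
  proof (rule fib_pullback[OF xf(2)])
    show "pullback K y x P q p"
      using pb unfolding pullback_def by (metis (no_types, lifting))
  qed
  ultimately have "\<exists>t. case t of (P, p, q) \<Rightarrow> product K X Y P p q \<and> p \<in> fib K \<and> q \<in> fib K"
    by auto
  from someI_ex[OF this]
  show "product K X Y (prd X Y) (pr1 X Y) (pr2 X Y)" "pr1 X Y \<in> fib K" "pr2 X Y \<in> fib K"
    by (auto simp: prd_def pr1_def pr2_def product_cone_def split: prod.splits)
qed

lemma pr_simps [simp]:
  assumes "X \<in> obj K" "Y \<in> obj K"
  shows "prd X Y \<in> obj K" "pr1 X Y \<in> arr K" "src K (pr1 X Y) = prd X Y" "tgt K (pr1 X Y) = X"
    "pr2 X Y \<in> arr K" "src K (pr2 X Y) = prd X Y" "tgt K (pr2 X Y) = Y"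
    "pr1 X Y \<in> fib K" "pr2 X Y \<in> fib K"
proof -
  have "pr1 X Y \<in> hom K (prd X Y) X" "pr2 X Y \<in> hom K (prd X Y) Y"
    using prd_product(1)[OF assms] unfolding product_def by blast+
  then show "prd X Y \<in> obj K" "pr1 X Y \<in> arr K" "src K (pr1 X Y) = prd X Y"
    "tgt K (pr1 X Y) = X" "pr2 X Y \<in> arr K" "src K (pr2 X Y) = prd X Y" "tgt K (pr2 X Y) = Y"
    using src_obj[of "pr1 X Y"] by (auto simp: hom_def)
qed (rule prd_product[OF assms])+

lemma tup_props:
  assumes "a \<in> arr K" "b \<in> arr K" "src K a = src K b"
  shows "tup a b \<in> hom K (src K a) (prd (tgt K a) (tgt K b)) \<and>
    pr1 (tgt K a) (tgt K b) \<cdot> tup a b = a \<and> pr2 (tgt K a) (tgt K b) \<cdot> tup a b = b"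
proof -
  have "a \<in> hom K (src K a) (tgt K a)" "b \<in> hom K (src K a) (tgt K b)"
    using assms by (auto simp: hom_def)
  from theI'[OF product_universal[OF prd_product(1)[OF tgt_obj[OF assms(1)] tgt_obj[OF assms(2)]] this]]
  show ?thesis unfolding tup_def .
qed

lemma tup_simps [simp]:
  assumes "a \<in> arr K" "b \<in> arr K" "src K a = src K b"
  shows "tup a b \<in> arr K" "src K (tup a b) = src K a" "tgt K (tup a b) = prd (tgt K a) (tgt K b)"
    "tgt K a = X \<Longrightarrow> tgt K b = Y \<Longrightarrow> pr1 X Y \<cdot> tup a b = a"
    "tgt K a = X \<Longrightarrow> tgt K b = Y \<Longrightarrow> pr2 X Y \<cdot> tup a b = b"
  using tup_props[OF assms] by (simp_all add: hom_def)

lemma pr_eqI: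
  assumes "u \<in> arr K" "v \<in> arr K" "src K u = src K v" "tgt K u = prd X Y" "tgt K v = prd X Y"
    "X \<in> obj K" "Y \<in> obj K" "pr1 X Y \<cdot> u = pr1 X Y \<cdot> v" "pr2 X Y \<cdot> u = pr2 X Y \<cdot> v"
  shows "u = v"
proof (rule product_joint_mono[OF prd_product(1)[OF assms(6,7)] _ _ assms(8,9)])
  show "u \<in> hom K (src K v) (prd X Y)" "v \<in> hom K (src K v) (prd X Y)"
    using assms(1-5) by (simp_all add: hom_def)
qed

lemma tup_cmp [simp]:
  assumes "a \<in> arr K" "b \<in> arr K" "src K a = src K b" "z \<in> arr K" "tgt K z = src K a"
  shows "tup a b \<cdot> z = tup (a \<cdot> z) (b \<cdot> z)"
  by (rule pr_eqI[of _ _ "tgt K a" "tgt K b"])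
    (use assms in \<open>simp_all add: tgt_obj cmp_eq_reassoc[OF tup_simps(4)] cmp_eq_reassoc[OF tup_simps(5)]\<close>)

lemma tup_eta [simp]:
  "u \<in> arr K \<Longrightarrow> X \<in> obj K \<Longrightarrow> Y \<in> obj K \<Longrightarrow> tgt K u = prd X Y \<Longrightarrow>
    tup (pr1 X Y \<cdot> u) (pr2 X Y \<cdot> u) = u"
  by (rule pr_eqI[of _ _ X Y]) simp_all

lemma tup_inject:
  assumes "tup a b = tup c d" "a \<in> arr K" "b \<in> arr K" "c \<in> arr K" "d \<in> arr K"
    "src K a = src K b" "src K c = src K d" "tgt K a = tgt K c" "tgt K b = tgt K d"
  shows "a = c" "b = d"
  using tup_simps(4,5)[of a b "tgt K a" "tgt K b"] tup_simps(4,5)[of c d "tgt K a" "tgt K b"]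
  unfolding assms(1)[symmetric] using assms(2-) by simp_all

text \<open>Any product cone may witness a pair fibration. The comparison with the chosen cone is an
  isomorphism, hence a fibration, and composing with it moves the property to
  \<open>tup a b\<close>.\<close>

lemma pair_fibration_iff:
  assumes X: "X \<in> obj K"
  shows "pair_fibration K R X a b \<longleftrightarrow> a \<in> hom K R X \<and> b \<in> hom K R X \<and> tup a b \<in> fib K"
proof
  assume "pair_fibration K R X a b"
  then obtain Q q1 q2 u where Q: "product K X X Q q1 q2" and u: "u \<in> hom K R Q"
    and ab: "q1 \<cdot> u = a" "q2 \<cdot> u = b" and uf: "u \<in> fib K"
    by (auto simp: pair_fibration_def)
  have q: "q1 \<in> hom K Q X" "q2 \<in> hom K Q X" using Q by (auto simp: product_def)
  then have a: "a \<in> hom K R X" "b \<in> hom K R X" using u ab cmp_hom by blast+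
  obtain j j' where j: "j \<in> hom K Q (prd X X)" "j' \<in> hom K (prd X X) Q"
    "j \<cdot> j' = ident K (prd X X)" "j' \<cdot> j = ident K Q" "pr1 X X \<cdot> j = q1" "pr2 X X \<cdot> j = q2"
    using product_comparison[OF Q prd_product(1)[OF X X]] by metis
  have "j \<in> fib K" using j iso_acyclic[of j] by (auto simp: iso_def hom_def)
  then have "j \<cdot> u \<in> fib K" using fib_cmp[OF uf] u j by (simp add: hom_def)
  moreover have "tup a b = j \<cdot> u"
    by (rule pr_eqI[of _ _ X X])
      (use j a u ab q X in \<open>auto simp: hom_def cmp_eq_reassoc[OF j(5)] cmp_eq_reassoc[OF j(6)]\<close>)
  ultimately show "a \<in> hom K R X \<and> b \<in> hom K R X \<and> tup a b \<in> fib K" using a by simp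
next
  assume "a \<in> hom K R X \<and> b \<in> hom K R X \<and> tup a b \<in> fib K"
  then show "pair_fibration K R X a b"
    using prd_product(1)[OF X X] X unfolding pair_fibration_def
    by (intro exI[of _ "prd X X"] exI[of _ "pr1 X X"] exI[of _ "pr2 X X"] exI[of _ "tup a b"])
      (auto simp: hom_def)
qed

section \<open>Pullback cones, two-out-of-three and the mapping path factorisation\<close>

lemma pullbackD:
  assumes "pullback K f g P p q"
  shows "p \<in> arr K" "q \<in> arr K" "src K p = P" "src K q = P" "tgt K p = src K f" "tgt K q = src K g"
    "f \<cdot> p = g \<cdot> q" "f \<in> arr K" "g \<in> arr K" "tgt K f = tgt K g"
  using assms by (auto simp: pullback_def hom_def)

lemma pullback_mediate:
  assumes "pullback K f g P p q" "a \<in> arr K" "b \<in> arr K" "src K a = src K b"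
    "tgt K a = src K f" "tgt K b = src K g" "f \<cdot> a = g \<cdot> b"
  obtains u where "u \<in> hom K (src K b) P" "p \<cdot> u = a" "q \<cdot> u = b"
  using assms unfolding pullback_def hom_def by blast

lemma pullback_joint_mono:
  assumes pb: "pullback K f g P p q" and u: "u \<in> hom K Z P" and v: "v \<in> hom K Z P"
    and eq: "p \<cdot> u = p \<cdot> v" "q \<cdot> u = q \<cdot> v"
  shows "u = v"
proof -
  note pq = pullbackD[OF pb]
  have "p \<cdot> u \<in> hom K Z (src K f)" "q \<cdot> u \<in> hom K Z (src K g)" "f \<cdot> (p \<cdot> u) = g \<cdot> (q \<cdot> u)"
    using pq u cmp_eq_reassoc[OF pq(7), of u] by (simp_all add: hom_def)
  then have "\<exists>!w. w \<in> hom K Z P \<and> p \<cdot> w = p \<cdot> u \<and> q \<cdot> w = q \<cdot> u"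
    using pb unfolding pullback_def by blast
  then show ?thesis using u v eq by metis
qed

text \<open>Two-out-of-three follows from two-out-of-six for a string padded with an identity: at
  the source end to reach \<open>g\<close>, at the target end to reach \<open>f\<close>.\<close>

lemma weq_cancel:
  assumes "f \<in> hom K A B" "g \<in> hom K B C" "g \<cdot> f \<in> weq K"
  shows "f \<in> weq K \<Longrightarrow> g \<in> weq K" "g \<in> weq K \<Longrightarrow> f \<in> weq K"
proof -
  have o: "A \<in> obj K" "C \<in> obj K" using assms hom_obj by blast+
  show "g \<in> weq K" if "f \<in> weq K"
    using two_out_of_six[of "ident K A" A A f B g C] assms that o by (auto simp: hom_def)
  show "f \<in> weq K" if "g \<in> weq K"
    using two_out_of_six[of f A B g C "ident K C" C] assms that o by (auto simp: hom_def)
qed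

lemma ident_weq: "A \<in> obj K \<Longrightarrow> ident K A \<in> weq K"
  using iso_acyclic[of "ident K A"] by (auto simp: iso_def hom_def)

text \<open>The mapping path object: a generalised element of \<open>V\<close> consists of
  \<open>x\<close>, \<open>q\<close> and a path from \<open>k x\<close> to \<open>q\<close>. The
  weak equivalence \<open>w\<close> inserts constant paths, and the fibration \<open>p\<close> reads
  off the endpoint \<open>q\<close>.\<close>

lemma weq_fib_factorisation:
  assumes k: "k \<in> hom K X Q"
  obtains V w p where "w \<in> hom K X V" "w \<in> weq K" "p \<in> hom K V Q" "p \<in> fib K" "p \<cdot> w = k"
proof -
  have o: "X \<in> obj K" "Q \<in> obj K" using k hom_obj by blast+
  obtain P r s t where P: "path_object K Q P r s t" using path_object_ex o by blast
  then have rst: "r \<in> hom K Q P" "s \<in> hom K P Q" "t \<in> hom K P Q" "r \<in> weq K"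
      "s \<cdot> r = ident K Q" "t \<cdot> r = ident K Q" and st: "tup s t \<in> fib K"
    using o by (auto simp: path_object_def pair_fibration_iff)
  have oP: "P \<in> obj K" using rst hom_obj by blast
  have sf: "s \<in> fib K"
    using fib_cmp[OF st, of "pr1 Q Q"] rst o by (auto simp: hom_def)
  have sw: "s \<in> weq K"
    using weq_cancel(1)[OF rst(1,2)] rst ident_weq o by simp
  define kk where "kk = tup (k \<cdot> pr1 X Q) (pr2 X Q)"
  have kk: "kk \<in> hom K (prd X Q) (prd Q Q)" using k o by (auto simp: kk_def hom_def)
  obtain V a v where pb: "pullback K (tup s t) kk V a v"
    using fib_pullback_ex[OF st, of kk] kk rst by (auto simp: hom_def)
  have vf: "v \<in> fib K" using fib_pullback[OF st pb] .
  have av: "a \<in> arr K" "v \<in> arr K" "src K a = V" "src K v = V" "tgt K a = P" "tgt K v = prd X Q"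
    using pullbackD[OF pb] rst kk by (auto simp: hom_def)
  have "tup (s \<cdot> a) (t \<cdot> a) = tup (k \<cdot> (pr1 X Q \<cdot> v)) (pr2 X Q \<cdot> v)"
    using pullbackD(7)[OF pb] av rst k o by (simp add: kk_def hom_def)
  then have sa: "s \<cdot> a = k \<cdot> (pr1 X Q \<cdot> v)" and ta: "t \<cdot> a = pr2 X Q \<cdot> v"
    using av rst k o by (auto dest: tup_inject simp: hom_def)
  \<comment> \<open>As \<open>q\<close> is the endpoint of the path, \<open>V\<close> is also the
    pullback of \<open>s\<close> along \<open>k\<close>. Since \<open>s\<close> is an acyclic
    fibration, so is the projection of \<open>V\<close> to \<open>X\<close>; \<open>w\<close> will
    be a section of it and therefore a weak equivalence.\<close>
  have pb2: "pullback K s k V a (pr1 X Q \<cdot> v)"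
    unfolding pullback_def
  proof (intro conjI allI impI)
    fix Z x y assume x: "x \<in> hom K Z (src K s)" and y: "y \<in> hom K Z (src K k)"
      and xy: "s \<cdot> x = k \<cdot> y"
    have "tup s t \<cdot> x = kk \<cdot> tup y (t \<cdot> x)"
      using x y xy rst k o by (simp add: kk_def hom_def)
    then obtain u where u: "u \<in> hom K Z V" "a \<cdot> u = x" "v \<cdot> u = tup y (t \<cdot> x)"
      using pullback_mediate[OF pb, of x "tup y (t \<cdot> x)"] x y rst k kk by (auto simp: hom_def)
    show "\<exists>!u. u \<in> hom K Z V \<and> a \<cdot> u = x \<and> pr1 X Q \<cdot> v \<cdot> u = y"
    proof (rule ex1I[of _ u])
      show "u \<in> hom K Z V \<and> a \<cdot> u = x \<and> pr1 X Q \<cdot> v \<cdot> u = y"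
        using u av x y rst k o by (simp add: hom_def)
      fix u' assume u': "u' \<in> hom K Z V \<and> a \<cdot> u' = x \<and> pr1 X Q \<cdot> v \<cdot> u' = y"
      have "pr2 X Q \<cdot> (v \<cdot> u') = t \<cdot> x"
        using u' av rst o cmp_eq_reassoc[OF ta, of u'] by (simp add: hom_def)
      moreover have u'a: "u' \<in> arr K" "src K u' = Z" "tgt K u' = V" "pr1 X Q \<cdot> v \<cdot> u' = y"
        using u' by (simp_all add: hom_def)
      moreover have "pr1 X Q \<cdot> (v \<cdot> u') = y" using u'a av o by simp
      ultimately have "v \<cdot> u' = tup y (t \<cdot> x)"
        using tup_eta[of "v \<cdot> u'" X Q] av o by simp
      then show "u' = u"
        using pullback_joint_mono[OF pb, of u' Z u] u u' by simp
    qed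
  qed (use av rst k o sa in \<open>auto simp: hom_def\<close>)
  have pw: "pr1 X Q \<cdot> v \<in> weq K"
    using acyclic_pullback[OF _ pb2] sf sw by blast
  have "tup s t \<cdot> (r \<cdot> k) = kk \<cdot> tup (ident K X) k"
    using rst k o cmp_eq_reassoc[OF rst(5), of k] cmp_eq_reassoc[OF rst(6), of k]
    by (simp add: hom_def kk_def)
  then obtain w where w: "w \<in> hom K X V" "a \<cdot> w = r \<cdot> k" "v \<cdot> w = tup (ident K X) k"
    using pullback_mediate[OF pb, of "r \<cdot> k" "tup (ident K X) k"] rst k kk o by (auto simp: hom_def)
  have "pr1 X Q \<cdot> v \<cdot> w = ident K X" using w av o k by (simp add: hom_def)
  then have "w \<in> weq K"
    using weq_cancel(2)[of w X V "pr1 X Q \<cdot> v" X] pw w av o ident_weq by (simp add: hom_def)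
  moreover have "pr2 X Q \<cdot> v \<in> fib K" using fib_cmp[OF vf, of "pr2 X Q"] av o by simp
  moreover have "pr2 X Q \<cdot> v \<cdot> w = k" using w av o k by (simp add: hom_def)
  ultimately show thesis
    using that[of w V "pr2 X Q \<cdot> v"] w av o by (simp add: hom_def)
qed

text \<open>Factor \<open>k\<close> as a weak equivalence \<open>w\<close> followed by a fibration
  \<open>p\<close>. By two-out-of-three \<open>q \<cdot> p\<close> is an acyclic fibration, so it
  has a section, and composing that section with \<open>p\<close> gives one of
  \<open>q\<close>.\<close>

lemma fibration_section:
  assumes q: "q \<in> fib K" and k: "k \<in> arr K" "tgt K k = src K q" and qk: "q \<cdot> k \<in> weq K"
  obtains e where "e \<in> hom K (tgt K q) (src K q)" "q \<cdot> e = ident K (tgt K q)"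
proof -
  have qa: "q \<in> arr K" using q fibD by blast
  obtain V w p where w: "w \<in> hom K (src K k) V" "w \<in> weq K" and p: "p \<in> hom K V (src K q)" "p \<in> fib K"
    and pw: "p \<cdot> w = k"
    using weq_fib_factorisation[of k "src K k" "src K q"] k by (auto simp: hom_def)
  have qp: "q \<cdot> p \<in> hom K V (tgt K q)" using p qa by (simp add: hom_def)
  have "(q \<cdot> p) \<cdot> w \<in> weq K" using qk pw p w qa by (simp add: hom_def)
  then have "q \<cdot> p \<in> weq K" using weq_cancel(1)[OF w(1) qp] w by blast
  moreover have "q \<cdot> p \<in> fib K" using fib_cmp[OF p(2) q] p by (simp add: hom_def)
  ultimately obtain e where "e \<in> hom K (tgt K q) V" "q \<cdot> p \<cdot> e = ident K (tgt K q)"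
    using acyclic_section[of "q \<cdot> p"] qp by (auto simp: hom_def)
  then show thesis using that[of "p \<cdot> e"] p qa by (simp add: hom_def)
qed


section \<open>Fibrations as predicates on generalised elements\<close>

text \<open>Only the existence of a factorisation is recorded. This matches the completions, where
  tracking maps and homotopies are merely required to exist, and it is what makes weak \<Pi>-types
  good enough as quantifiers.\<close>

definition lifts :: "'m \<Rightarrow> 'm \<Rightarrow> bool" where
  "lifts f z \<longleftrightarrow> (\<exists>h \<in> arr K. tgt K h = src K f \<and> f \<cdot> h = z)"

lemma lifts_substitution:
  assumes f: "f \<in> fib K" and g: "g \<in> arr K" "tgt K g = tgt K f"
  obtains f' where "f' \<in> fib K" "tgt K f' = src K g"
    "\<And>z. z \<in> arr K \<Longrightarrow> tgt K z = src K g \<Longrightarrow> lifts f' z \<longleftrightarrow> lifts f (g \<cdot> z)"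
proof -
  have fa: "f \<in> arr K" using f fibD by blast
  obtain P p q where pb: "pullback K f g P p q"
    using fib_pullback_ex[OF f g(1)] g by auto
  note pq = pullbackD[OF pb]
  have "lifts q z \<longleftrightarrow> lifts f (g \<cdot> z)" if z: "z \<in> arr K" "tgt K z = src K g" for z
  proof
    assume "lifts q z"
    then obtain h where h: "h \<in> arr K" "tgt K h = P" "q \<cdot> h = z"
      using pq by (auto simp: lifts_def)
    have "f \<cdot> (p \<cdot> h) = g \<cdot> z"
      using cmp_eq_reassoc[OF pq(7), of h] pq h fa g by simp
    then show "lifts f (g \<cdot> z)" using pq h unfolding lifts_def by (intro bexI[of _ "p \<cdot> h"]) auto
  next
    assume "lifts f (g \<cdot> z)"
    then obtain h where h: "h \<in> arr K" "tgt K h = src K f" "f \<cdot> h = g \<cdot> z"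
      by (auto simp: lifts_def)
    have "src K h = src K z" using h z g fa by (metis cmp_arr(2))
    then obtain u where "u \<in> hom K (src K z) P" "q \<cdot> u = z"
      using pullback_mediate[OF pb h(1) z(1) _ h(2) z(2) h(3)] by blast
    then show "lifts q z" using pq unfolding lifts_def hom_def by auto
  qed
  moreover have "q \<in> fib K" using fib_pullback[OF f pb] .
  ultimately show thesis using that pq by blast
qed

text \<open>The conjunction is the composite of \<open>f\<close> with the pullback of
  \<open>g\<close> along \<open>f\<close>: a lift of \<open>z\<close> through \<open>f\<close> lifts
  further exactly when \<open>z\<close> lifts through \<open>g\<close>.\<close>

lemma lifts_conj:
  assumes f: "f \<in> fib K" and g: "g \<in> fib K" "tgt K g = tgt K f"
  obtains f' where "f' \<in> fib K" "tgt K f' = tgt K f"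
    "\<And>z. z \<in> arr K \<Longrightarrow> tgt K z = tgt K f \<Longrightarrow> lifts f' z \<longleftrightarrow> lifts f z \<and> lifts g z"
proof -
  have fa: "f \<in> arr K" using f fibD by blast
  obtain g' where g': "g' \<in> fib K" "tgt K g' = src K f"
    and l: "\<And>z. z \<in> arr K \<Longrightarrow> tgt K z = src K f \<Longrightarrow> lifts g' z \<longleftrightarrow> lifts g (f \<cdot> z)"
    using lifts_substitution[OF g(1) fa] g(2) by metis
  have g'a: "g' \<in> arr K" using g' fibD by blast
  have "lifts (f \<cdot> g') z \<longleftrightarrow> lifts f z \<and> lifts g z" if z: "z \<in> arr K" "tgt K z = tgt K f" for z
  proof
    assume "lifts (f \<cdot> g') z"
    then obtain h where h: "h \<in> arr K" "tgt K h = src K g'" "f \<cdot> (g' \<cdot> h) = z"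
      using fa g'a g' by (auto simp: lifts_def)
    have "lifts g' (g' \<cdot> h)" using h unfolding lifts_def by blast
    then have "lifts g z" using l[of "g' \<cdot> h"] h g' g'a by simp
    moreover have "lifts f z"
      unfolding lifts_def using h g' g'a by (intro bexI[of _ "g' \<cdot> h"]) auto
    ultimately show "lifts f z \<and> lifts g z" by blast
  next
    assume *: "lifts f z \<and> lifts g z"
    then obtain h where h: "h \<in> arr K" "tgt K h = src K f" "f \<cdot> h = z" by (auto simp: lifts_def)
    then have "lifts g' h" using * l by simp
    then obtain k where "k \<in> arr K" "tgt K k = src K g'" "g' \<cdot> k = h" by (auto simp: lifts_def)
    then show "lifts (f \<cdot> g') z"
      unfolding lifts_def using h fa g' g'a by (intro bexI[of _ k]) auto
  qed
  moreover have "f \<cdot> g' \<in> fib K" using fib_cmp[OF g'(1) f] g' by simp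
  ultimately show thesis using that[of "f \<cdot> g'"] fa g' g'a by simp
qed

end


section \<open>Homotopy equivalence relations\<close>

text \<open>The relations and completions are defined for unextended \<open>pcat\<close> records only.\<close>

locale plain_path_category = path_category K for K :: "('o, 'm) pcat" (structure)
begin

section \<open>Relatedness of generalised elements\<close>

definition related :: "('o, 'm) relobj \<Rightarrow> 'm \<Rightarrow> 'm \<Rightarrow> bool" where
  "related A a b \<longleftrightarrow> (\<exists>h \<in> arr K. tgt K h = rel A \<and> leg1 A \<cdot> h = a \<and> leg2 A \<cdot> h = b)"


lemma relatedE:
  assumes "related A a b"
  obtains h where "h \<in> arr K" "tgt K h = rel A" "leg1 A \<cdot> h = a" "leg2 A \<cdot> h = b"
  using assms by (auto simp: related_def)

lemma hequiv_rel_carr: "hequiv_rel K A \<Longrightarrow> carr A \<in> obj K"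
  by (simp add: hequiv_rel_def Let_def)

lemma hequiv_rel_legs:
  assumes "hequiv_rel K A"
  shows "leg1 A \<in> arr K" "src K (leg1 A) = rel A" "tgt K (leg1 A) = carr A"
    "leg2 A \<in> arr K" "src K (leg2 A) = rel A" "tgt K (leg2 A) = carr A"
    "tup (leg1 A) (leg2 A) \<in> fib K"
proof -
  have "leg1 A \<in> hom K (rel A) (carr A)" "leg2 A \<in> hom K (rel A) (carr A)"
    "pair_fibration K (rel A) (carr A) (leg1 A) (leg2 A)"
    using assms unfolding hequiv_rel_def Let_def by blast+
  then show "leg1 A \<in> arr K" "src K (leg1 A) = rel A" "tgt K (leg1 A) = carr A"
    "leg2 A \<in> arr K" "src K (leg2 A) = rel A" "tgt K (leg2 A) = carr A"
    "tup (leg1 A) (leg2 A) \<in> fib K"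
    using pair_fibration_iff[OF hequiv_rel_carr[OF assms]] by (simp_all add: hom_def)
qed

lemma related_typed:
  assumes "hequiv_rel K A" "related A a b"
  shows "a \<in> arr K" "b \<in> arr K" "src K a = src K b" "tgt K a = carr A" "tgt K b = carr A"
proof -
  note l = hequiv_rel_legs[OF assms(1)]
  obtain h where h: "h \<in> arr K" "tgt K h = rel A" "leg1 A \<cdot> h = a" "leg2 A \<cdot> h = b"
    using assms(2) by (rule relatedE)
  show "a \<in> arr K" "src K a = src K b" "tgt K a = carr A"
    unfolding h(3,4)[symmetric] using l h(1,2) by simp_all
  show "b \<in> arr K" "tgt K b = carr A"
    unfolding h(4)[symmetric] using l h(1,2) by simp_all
qed

lemma related_legs: "hequiv_rel K A \<Longrightarrow> related A (leg1 A) (leg2 A)"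
  unfolding related_def using hequiv_rel_legs[of A] src_obj[of "leg1 A"]
  by (intro bexI[of _ "ident K (rel A)"]) simp_all

lemma lifts_legs:
  assumes A: "hequiv_rel K A" and a: "a \<in> arr K" "tgt K a = carr A"
    and b: "b \<in> arr K" "tgt K b = carr A" and ab: "src K a = src K b"
  shows "lifts (tup (leg1 A) (leg2 A)) (tup a b) \<longleftrightarrow> related A a b"
proof -
  note l = hequiv_rel_legs[OF A]
  have "tup (leg1 A) (leg2 A) \<cdot> h = tup a b \<longleftrightarrow> leg1 A \<cdot> h = a \<and> leg2 A \<cdot> h = b"
    if "h \<in> arr K" "tgt K h = rel A" for h
    using tup_inject[of "leg1 A \<cdot> h" "leg2 A \<cdot> h" a b] l that a b ab by auto
  then show ?thesis using l unfolding lifts_def related_def by auto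
qed

lemma related_refl:
  assumes A: "hequiv_rel K A" and a: "a \<in> arr K" "tgt K a = carr A"
  shows "related A a a"
proof -
  note l = hequiv_rel_legs[OF A]
  obtain r where r: "r \<in> hom K (carr A) (rel A)" "leg1 A \<cdot> r = ident K (carr A)"
      "leg2 A \<cdot> r = ident K (carr A)"
    using A by (auto simp: hequiv_rel_def Let_def)
  show ?thesis unfolding related_def
    using r(1) l a cmp_eq_reassoc[OF r(2), of a] cmp_eq_reassoc[OF r(3), of a]
    by (intro bexI[of _ "r \<cdot> a"]) (simp_all add: hom_def)
qed

lemma related_sym:
  assumes A: "hequiv_rel K A" and ab: "related A a b"
  shows "related A b a"
proof -
  note l = hequiv_rel_legs[OF A]
  obtain s where s: "s \<in> hom K (rel A) (rel A)" "leg1 A \<cdot> s = leg2 A" "leg2 A \<cdot> s = leg1 A"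
    using A by (auto simp: hequiv_rel_def Let_def)
  obtain h where h: "h \<in> arr K" "tgt K h = rel A" "leg1 A \<cdot> h = a" "leg2 A \<cdot> h = b"
    using ab by (rule relatedE)
  show ?thesis unfolding related_def
    using s(1) l h cmp_eq_reassoc[OF s(2), of h] cmp_eq_reassoc[OF s(3), of h]
    by (intro bexI[of _ "s \<cdot> h"]) (simp_all add: hom_def)
qed

lemma related_trans:
  assumes A: "hequiv_rel K A" and ab: "related A a b" and bc: "related A b c"
  shows "related A a c"
proof -
  note l = hequiv_rel_legs[OF A]
  obtain Q q1 q2 t where pb: "pullback K (leg2 A) (leg1 A) Q q1 q2" and t: "t \<in> hom K Q (rel A)"
      "leg1 A \<cdot> t = leg1 A \<cdot> q1" "leg2 A \<cdot> t = leg2 A \<cdot> q2"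
    using A unfolding hequiv_rel_def Let_def by blast
  note q = pullbackD[OF pb]
  obtain h where h: "h \<in> arr K" "tgt K h = rel A" "leg1 A \<cdot> h = a" "leg2 A \<cdot> h = b"
    using ab by (rule relatedE)
  obtain k where k: "k \<in> arr K" "tgt K k = rel A" "leg1 A \<cdot> k = b" "leg2 A \<cdot> k = c"
    using bc by (rule relatedE)
  have "src K h = src K k" using h k l by (metis cmp_arr(2))
  then obtain u where u: "u \<in> hom K (src K k) Q" "q1 \<cdot> u = h" "q2 \<cdot> u = k"
    using pullback_mediate[OF pb h(1) k(1)] h k l by metis
  have "leg1 A \<cdot> (t \<cdot> u) = a" "leg2 A \<cdot> (t \<cdot> u) = c"
    using cmp_eq_reassoc[OF t(2), of u] cmp_eq_reassoc[OF t(3), of u] t(1) u(1) l q(1-6)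
    by (simp_all add: hom_def u(2,3) h(3) k(4))
  then show ?thesis unfolding related_def
    using t(1) u(1) by (intro bexI[of _ "t \<cdot> u"]) (simp_all add: hom_def)
qed

lemma related_cmp:
  assumes A: "hequiv_rel K A" and ab: "related A a b" and z: "z \<in> arr K" "tgt K z = src K a"
  shows "related A (a \<cdot> z) (b \<cdot> z)"
proof -
  note l = hequiv_rel_legs[OF A]
  obtain h where h: "h \<in> arr K" "tgt K h = rel A" "leg1 A \<cdot> h = a" "leg2 A \<cdot> h = b"
    using ab by (rule relatedE)
  have "src K a = src K h" using h l by (metis cmp_arr(2))
  then show ?thesis unfolding related_def
    using h(1,2) z l cmp_eq_reassoc[OF h(3), of z] cmp_eq_reassoc[OF h(4), of z]
    by (intro bexI[of _ "h \<cdot> z"]) simp_all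
qed

text \<open>The structure maps are instances of the laws of \<open>E\<close> at generic elements:
  reflexivity at the identity of \<open>X\<close>, symmetry at the two legs, transitivity at the
  projections from the pullback of composable pairs.\<close>

lemma hequiv_rel_of_fibration:
  assumes X: "X \<in> obj K" and f: "f \<in> fib K" "tgt K f = prd X X"
    and E: "\<And>a b. a \<in> arr K \<Longrightarrow> b \<in> arr K \<Longrightarrow> src K a = src K b \<Longrightarrow> tgt K a = X \<Longrightarrow> tgt K b = X \<Longrightarrow>
      lifts f (tup a b) \<longleftrightarrow> E a b"
    and E_refl: "\<And>a. a \<in> arr K \<Longrightarrow> tgt K a = X \<Longrightarrow> E a a"
    and E_sym: "\<And>a b. E a b \<Longrightarrow> E b a"
    and E_trans: "\<And>a b c. E a b \<Longrightarrow> E b c \<Longrightarrow> E a c"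
  obtains A where "hequiv_rel K A" "carr A = X"
    "\<And>a b. a \<in> arr K \<Longrightarrow> b \<in> arr K \<Longrightarrow> src K a = src K b \<Longrightarrow> tgt K a = X \<Longrightarrow> tgt K b = X \<Longrightarrow>
      related A a b \<longleftrightarrow> E a b"
proof -
  have fa: "f \<in> arr K" using f fibD by blast
  define l1 l2 where "l1 = pr1 X X \<cdot> f" and "l2 = pr2 X X \<cdot> f"
  have l: "l1 \<in> arr K" "l2 \<in> arr K" "src K l1 = src K f" "src K l2 = src K f"
      "tgt K l1 = X" "tgt K l2 = X" "l1 \<in> fib K" "l2 \<in> fib K" "tup l1 l2 = f"
    using X f fa fib_cmp[OF f(1), of "pr1 X X"] fib_cmp[OF f(1), of "pr2 X X"]
    by (simp_all add: l1_def l2_def)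
  define A where "A = \<lparr>carr = X, rel = src K f, leg1 = l1, leg2 = l2\<rparr>"
  have A: "related A a b \<longleftrightarrow> E a b"
    if ab: "a \<in> arr K" "b \<in> arr K" "src K a = src K b" "tgt K a = X" "tgt K b = X" for a b
  proof -
    have "f \<cdot> h = tup a b \<longleftrightarrow> l1 \<cdot> h = a \<and> l2 \<cdot> h = b" if "h \<in> arr K" "tgt K h = src K f" for h
    proof -
      have "f \<cdot> h = tup (l1 \<cdot> h) (l2 \<cdot> h)"
        using tup_cmp[of l1 l2 h] l that by simp
      then show ?thesis using tup_inject[of "l1 \<cdot> h" "l2 \<cdot> h" a b] l that ab by auto
    qed
    then have "lifts f (tup a b) \<longleftrightarrow> related A a b"
      unfolding lifts_def related_def A_def by auto
    then show ?thesis using E ab by blast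
  qed
  have oR: "src K f \<in> obj K" using fa src_obj by blast
  \<comment> \<open>The tautological related pair: it lifts through \<open>f\<close> by the
    identity.\<close>
  have legs: "E l1 l2"
  proof -
    have "related A l1 l2" unfolding related_def A_def
      using l oR by (intro bexI[of _ "ident K (src K f)"]) simp_all
    then show ?thesis using A l by simp
  qed
  have "related A (ident K X) (ident K X)" using A E_refl X by simp
  then obtain r where r: "r \<in> arr K" "tgt K r = src K f" "l1 \<cdot> r = ident K X" "l2 \<cdot> r = ident K X"
    by (rule relatedE) (simp add: A_def)
  have rs: "src K r = X" using r(3) r(1,2) l X by (metis cmp_arr(2) ident_arr(2))
  have "related A l2 l1" using A E_sym[OF legs] l by simp
  then obtain s where s: "s \<in> arr K" "tgt K s = src K f" "l1 \<cdot> s = l2" "l2 \<cdot> s = l1"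
    by (rule relatedE) (simp add: A_def)
  have ss: "src K s = src K f" using s(3) s(1,2) l by (metis cmp_arr(2))
  obtain Q q1 q2 where pb: "pullback K l2 l1 Q q1 q2"
    using fib_pullback_ex[OF l(8,1)] l by auto
  note q = pullbackD[OF pb]
  have lq: "related A (l1 \<cdot> q) (l2 \<cdot> q)" if "q \<in> arr K" "tgt K q = src K f" for q
    unfolding related_def using that by (auto simp: A_def)
  have "E (l1 \<cdot> q1) (l2 \<cdot> q2)"
  proof (rule E_trans)
    show "E (l1 \<cdot> q1) (l2 \<cdot> q1)" using lq[of q1] A q l by simp
    show "E (l2 \<cdot> q1) (l2 \<cdot> q2)" using lq[of q2] A q l by simp
  qed
  then have "related A (l1 \<cdot> q1) (l2 \<cdot> q2)" using A q l by simp
  then obtain t where t: "t \<in> arr K" "tgt K t = src K f" "l1 \<cdot> t = l1 \<cdot> q1" "l2 \<cdot> t = l2 \<cdot> q2"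
    by (rule relatedE) (simp add: A_def)
  have ts: "src K t = Q" using t(3) t(1,2) l q by (metis cmp_arr(2))
  have "hequiv_rel K A"
    unfolding hequiv_rel_def Let_def A_def relobj.simps
  proof (intro conjI X)
    show "l1 \<in> hom K (src K f) X" "l2 \<in> hom K (src K f) X" using l by (simp_all add: hom_def)
    then show "pair_fibration K (src K f) X l1 l2" using pair_fibration_iff[OF X] l f by simp
    show "\<exists>\<rho>\<in>hom K X (src K f). l1 \<cdot> \<rho> = ident K X \<and> l2 \<cdot> \<rho> = ident K X"
      using r rs by (intro bexI[of _ r]) (simp_all add: hom_def)
    show "\<exists>\<sigma>\<in>hom K (src K f) (src K f). l1 \<cdot> \<sigma> = l2 \<and> l2 \<cdot> \<sigma> = l1"
      using s ss by (intro bexI[of _ s]) (simp_all add: hom_def)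
    show "\<exists>Q q1 q2. pullback K l2 l1 Q q1 q2 \<and>
        (\<exists>\<tau>\<in>hom K Q (src K f). l1 \<cdot> \<tau> = l1 \<cdot> q1 \<and> l2 \<cdot> \<tau> = l2 \<cdot> q2)"
    proof (intro exI conjI)
      show "pullback K l2 l1 Q q1 q2" by (rule pb)
      show "\<exists>\<tau>\<in>hom K Q (src K f). l1 \<cdot> \<tau> = l1 \<cdot> q1 \<and> l2 \<cdot> \<tau> = l2 \<cdot> q2"
        using t ts by (intro bexI[of _ t]) (simp_all add: hom_def)
    qed
  qed
  moreover have "carr A = X" by (simp add: A_def)
  ultimately show thesis using that A by blast
qed

text \<open>These are the atomic predicates, obtained by substituting the pair of terms
  \<open>(p, q)\<close> into the relation. All the fibrations that are quantified later are of this
  kind.\<close>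

lemma related_preimage_fibration:
  assumes A: "hequiv_rel K A" and p: "p \<in> arr K" "tgt K p = carr A"
    and q: "q \<in> arr K" "tgt K q = carr A" and pq: "src K p = src K q"
  obtains f where "f \<in> fib K" "tgt K f = src K p"
    "\<And>z. z \<in> arr K \<Longrightarrow> tgt K z = src K p \<Longrightarrow> lifts f z \<longleftrightarrow> related A (p \<cdot> z) (q \<cdot> z)"
proof -
  note l = hequiv_rel_legs[OF A]
  have "tup p q \<in> arr K" "tgt K (tup p q) = tgt K (tup (leg1 A) (leg2 A))" "src K (tup p q) = src K p"
    using p q pq l by simp_all
  from lifts_substitution[OF l(7) this(1,2)] this(3)
  obtain f where f: "f \<in> fib K" "tgt K f = src K p"
    "\<And>z. z \<in> arr K \<Longrightarrow> tgt K z = src K p \<Longrightarrow>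
      lifts f z \<longleftrightarrow> lifts (tup (leg1 A) (leg2 A)) (tup p q \<cdot> z)" by metis
  show thesis
  proof (rule that[OF f(1,2)])
    fix z assume z: "z \<in> arr K" "tgt K z = src K p"
    have "lifts (tup (leg1 A) (leg2 A)) (tup (p \<cdot> z) (q \<cdot> z)) \<longleftrightarrow> related A (p \<cdot> z) (q \<cdot> z)"
      by (rule lifts_legs[OF A]) (use z p q pq in simp_all)
    then show "lifts f z \<longleftrightarrow> related A (p \<cdot> z) (q \<cdot> z)"
      using f(3)[OF z] z p q pq by simp
  qed
qed

text \<open>One construction with two uses: for the projections of a product it yields the products
  of the completions, and for the two legs of a relation it yields the path objects of the exact
  completion.\<close>

lemma hequiv_rel_jointly_induced:
  assumes A: "hequiv_rel K A" and B: "hequiv_rel K B"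
    and p: "p \<in> hom K P (carr A)" and q: "q \<in> hom K P (carr B)"
  obtains D where "hequiv_rel K D" "carr D = P"
    "\<And>a b. a \<in> arr K \<Longrightarrow> b \<in> arr K \<Longrightarrow> src K a = src K b \<Longrightarrow> tgt K a = P \<Longrightarrow> tgt K b = P \<Longrightarrow>
      related D a b \<longleftrightarrow> related A (p \<cdot> a) (p \<cdot> b) \<and> related B (q \<cdot> a) (q \<cdot> b)"
proof -
  have P: "P \<in> obj K" using p hom_obj by blast
  have p': "p \<in> arr K" "src K p = P" "tgt K p = carr A" and q': "q \<in> arr K" "src K q = P" "tgt K q = carr B"
    using p q by (simp_all add: hom_def)
  obtain f where f: "f \<in> fib K" "tgt K f = prd P P" "\<And>z. z \<in> arr K \<Longrightarrow> tgt K z = prd P P \<Longrightarrow>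
      lifts f z \<longleftrightarrow> related A (p \<cdot> (pr1 P P \<cdot> z)) (p \<cdot> (pr2 P P \<cdot> z))"
    by (rule related_preimage_fibration[OF A, of "p \<cdot> pr1 P P" "p \<cdot> pr2 P P"]) (use p' P in simp_all)
  obtain g where g: "g \<in> fib K" "tgt K g = prd P P" "\<And>z. z \<in> arr K \<Longrightarrow> tgt K z = prd P P \<Longrightarrow>
      lifts g z \<longleftrightarrow> related B (q \<cdot> (pr1 P P \<cdot> z)) (q \<cdot> (pr2 P P \<cdot> z))"
    by (rule related_preimage_fibration[OF B, of "q \<cdot> pr1 P P" "q \<cdot> pr2 P P"]) (use q' P in simp_all)
  obtain d where d: "d \<in> fib K" "tgt K d = prd P P"
      "\<And>z. z \<in> arr K \<Longrightarrow> tgt K z = prd P P \<Longrightarrow> lifts d z \<longleftrightarrow> lifts f z \<and> lifts g z"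
    using lifts_conj[OF f(1) g(1)] f(2) g(2) by metis
  let ?E = "\<lambda>a b. related A (p \<cdot> a) (p \<cdot> b) \<and> related B (q \<cdot> a) (q \<cdot> b)"
  show thesis
  proof (rule hequiv_rel_of_fibration[OF P d(1,2), of ?E])
    fix a b assume "a \<in> arr K" "b \<in> arr K" "src K a = src K b" "tgt K a = P" "tgt K b = P"
    then show "lifts d (tup a b) \<longleftrightarrow> ?E a b" using d(3) f(3) g(3) by simp
  next
    fix a assume "a \<in> arr K" "tgt K a = P"
    then show "?E a a" using p' q' by (simp add: related_refl[OF A] related_refl[OF B])
  qed (use that related_sym[OF A] related_sym[OF B] related_trans[OF A] related_trans[OF B] in blast)+
qed

text \<open>
  The pullback of the relation along \<open>(a, b)\<close> is a fibration over which \<open>r\<close> lifts by reflexivity,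
  so it has a section. For \<open>r\<close> the reflexivity map of a path object this says that homotopic maps
  are related.
\<close>

lemma related_if_equal_on_weq:
  assumes A: "hequiv_rel K A" and r: "r \<in> arr K" "r \<in> weq K"
    and a: "a \<in> arr K" "src K a = tgt K r" "tgt K a = carr A"
    and b: "b \<in> arr K" "src K b = tgt K r" "tgt K b = carr A"
    and eq: "a \<cdot> r = b \<cdot> r"
  shows "related A a b"
proof -
  obtain q where q: "q \<in> fib K" "tgt K q = tgt K r"
    "\<And>z. z \<in> arr K \<Longrightarrow> tgt K z = tgt K r \<Longrightarrow> lifts q z \<longleftrightarrow> related A (a \<cdot> z) (b \<cdot> z)"
    by (rule related_preimage_fibration[OF A, of a b]) (use a b in simp_all)
  have "related A (a \<cdot> r) (b \<cdot> r)" unfolding eq by (rule related_refl[OF A]) (use r b in simp_all)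
  then obtain k where k: "k \<in> arr K" "tgt K k = src K q" "q \<cdot> k = r"
    using q(3)[of r] r by (auto simp: lifts_def)
  obtain e where e: "e \<in> hom K (tgt K q) (src K q)" "q \<cdot> e = ident K (tgt K q)"
    using fibration_section[OF q(1) k(1,2)] k(3) r by metis
  have o: "tgt K r \<in> obj K" using r tgt_obj by blast
  have "lifts q (ident K (tgt K r))"
    unfolding lifts_def using e q(2) by (intro bexI[of _ e]) (simp_all add: hom_def)
  then show ?thesis using q(3)[of "ident K (tgt K r)"] o a b by simp
qed

text \<open>A tracking map is the preservation property evaluated at the generic related pair, the
  two legs of \<open>A\<close>. Conversely every related pair factors through the legs, so it is
  carried along by the tracking map.\<close>

lemma ex_maps_iff:
  assumes A: "hequiv_rel K A" and B: "hequiv_rel K B"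
  shows "f \<in> ex_maps K A B \<longleftrightarrow>
    f \<in> hom K (carr A) (carr B) \<and> (\<forall>a b. related A a b \<longrightarrow> related B (f \<cdot> a) (f \<cdot> b))"
proof
  note lA = hequiv_rel_legs[OF A] and lB = hequiv_rel_legs[OF B]
  assume "f \<in> ex_maps K A B"
  then obtain \<phi> where f: "f \<in> hom K (carr A) (carr B)" and \<phi>: "\<phi> \<in> hom K (rel A) (rel B)"
      "leg1 B \<cdot> \<phi> = f \<cdot> leg1 A" "leg2 B \<cdot> \<phi> = f \<cdot> leg2 A"
    by (auto simp: ex_maps_def)
  have "related B (f \<cdot> a) (f \<cdot> b)" if ab: "related A a b" for a b
  proof -
    obtain h where h: "h \<in> arr K" "tgt K h = rel A" "leg1 A \<cdot> h = a" "leg2 A \<cdot> h = b"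
      using ab by (rule relatedE)
    have "leg1 B \<cdot> (\<phi> \<cdot> h) = f \<cdot> a" "leg2 B \<cdot> (\<phi> \<cdot> h) = f \<cdot> b"
      using cmp_eq_reassoc[OF \<phi>(2), of h] cmp_eq_reassoc[OF \<phi>(3), of h] \<phi>(1) h(1,2) f lA lB
      by (simp_all add: hom_def h(3,4))
    then show ?thesis
      unfolding related_def using \<phi>(1) h(1,2) by (intro bexI[of _ "\<phi> \<cdot> h"]) (simp_all add: hom_def)
  qed
  with f show "f \<in> hom K (carr A) (carr B) \<and> (\<forall>a b. related A a b \<longrightarrow> related B (f \<cdot> a) (f \<cdot> b))"
    by blast
next
  note lA = hequiv_rel_legs[OF A] and lB = hequiv_rel_legs[OF B]
  assume *: "f \<in> hom K (carr A) (carr B) \<and> (\<forall>a b. related A a b \<longrightarrow> related B (f \<cdot> a) (f \<cdot> b))"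
  then have "related B (f \<cdot> leg1 A) (f \<cdot> leg2 A)" using related_legs[OF A] by blast
  then obtain h where h: "h \<in> arr K" "tgt K h = rel B" "leg1 B \<cdot> h = f \<cdot> leg1 A" "leg2 B \<cdot> h = f \<cdot> leg2 A"
    by (rule relatedE)
  have "f \<in> arr K" "src K f = carr A" using * by (simp_all add: hom_def)
  then have "src K h = rel A" using h lA lB by (metis cmp_arr(2))
  with * h show "f \<in> ex_maps K A B" unfolding ex_maps_def hom_def by blast
qed

lemma ex_sim_iff:
  assumes A: "hequiv_rel K A" and B: "hequiv_rel K B"
  shows "(f, g) \<in> ex_sim K A B \<longleftrightarrow> f \<in> ex_maps K A B \<and> g \<in> ex_maps K A B \<and> related B f g"
proof -
  have "related B f g \<longleftrightarrow> (\<exists>H \<in> hom K (carr A) (rel B). leg1 B \<cdot> H = f \<and> leg2 B \<cdot> H = g)"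
    if f: "f \<in> ex_maps K A B"
  proof
    assume "related B f g"
    then obtain h where h: "h \<in> arr K" "tgt K h = rel B" "leg1 B \<cdot> h = f" "leg2 B \<cdot> h = g"
      by (rule relatedE)
    have "src K f = carr A" using f by (simp add: ex_maps_def hom_def)
    then have "src K h = carr A" using h hequiv_rel_legs[OF B] by (metis cmp_arr(2))
    then show "\<exists>H \<in> hom K (carr A) (rel B). leg1 B \<cdot> H = f \<and> leg2 B \<cdot> H = g"
      using h by (intro bexI[of _ h]) (simp_all add: hom_def)
  qed (auto simp: related_def hom_def)
  then show ?thesis unfolding ex_sim_def by blast
qed

lemma over_simps:
  "a \<in> hom (over K I) p q \<Longrightarrow> umap a \<in> hom K (src K p) (src K q)"
  "a \<in> weq (over K I) \<Longrightarrow> umap a \<in> weq K"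
  "umap (b \<cdot>\<^bsub>over K I\<^esub> a) = umap b \<cdot> umap a"
  "umap (ident (over K I) p) = ident K (src K p)"
  by (auto simp: over_def Let_def hom_def)

text \<open>After forgetting the base, the reflexivity map of the path object is still a weak
  equivalence, and the two endpoint maps agree after it. Hence their composites with
  \<open>k\<close> are related, and it remains to precompose with the homotopy.\<close>

lemma fibrewise_homotopic_related:
  assumes A: "hequiv_rel K A" and fg: "fibrewise_homotopic K p f g" and k: "k \<in> hom K (src K p) (carr A)"
  shows "related A (k \<cdot> f) (k \<cdot> g)"
proof -
  obtain Y P r s t h where P: "path_object (over K (tgt K p)) p P r s t"
    and h: "h \<in> hom K Y (src K P)" "umap s \<cdot> h = f" "umap t \<cdot> h = g"
    using fg unfolding fibrewise_homotopic_def by blast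
  have rst: "umap r \<in> hom K (src K p) (src K P)" "umap r \<in> weq K"
      "umap s \<in> hom K (src K P) (src K p)" "umap t \<in> hom K (src K P) (src K p)"
      "umap s \<cdot> umap r = ident K (src K p)" "umap t \<cdot> umap r = ident K (src K p)"
    using P over_simps
    unfolding path_object_def by metis+
  have "related A (k \<cdot> umap s) (k \<cdot> umap t)"
    by (rule related_if_equal_on_weq[OF A, of "umap r"]) (use rst k in \<open>simp_all add: hom_def\<close>)
  from related_cmp[OF A this, of h] show ?thesis
    using h(1) rst k by (simp add: hom_def h(2,3))
qed

text \<open>A specification instead of a construction: the representing object depends on choices of
  pullbacks, while later arguments refer to its effect on generalised elements.\<close>

definition prod_rel :: "('o, 'm) relobj \<Rightarrow> ('o, 'm) relobj \<Rightarrow> ('o, 'm) relobj \<Rightarrow> bool" where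
  "prod_rel A B D \<longleftrightarrow> hequiv_rel K D \<and> carr D = prd (carr A) (carr B) \<and>
     (\<forall>a b. a \<in> arr K \<longrightarrow> b \<in> arr K \<longrightarrow> src K a = src K b \<longrightarrow> tgt K a = carr D \<longrightarrow> tgt K b = carr D \<longrightarrow>
       (related D a b \<longleftrightarrow> related A (pr1 (carr A) (carr B) \<cdot> a) (pr1 (carr A) (carr B) \<cdot> b) \<and>
          related B (pr2 (carr A) (carr B) \<cdot> a) (pr2 (carr A) (carr B) \<cdot> b)))"

lemma prod_rel_ex:
  assumes A: "hequiv_rel K A" and B: "hequiv_rel K B"
  obtains D where "prod_rel A B D"
proof -
  have o: "carr A \<in> obj K" "carr B \<in> obj K" using A B hequiv_rel_carr by blast+
  have "pr1 (carr A) (carr B) \<in> hom K (prd (carr A) (carr B)) (carr A)"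
    "pr2 (carr A) (carr B) \<in> hom K (prd (carr A) (carr B)) (carr B)"
    using o by (simp_all add: hom_def)
  from hequiv_rel_jointly_induced[OF A B this] show thesis
    using that unfolding prod_rel_def by metis
qed

lemma prod_relD:
  assumes D: "prod_rel A B D" and ab: "related D a b"
  shows "related A (pr1 (carr A) (carr B) \<cdot> a) (pr1 (carr A) (carr B) \<cdot> b)"
    "related B (pr2 (carr A) (carr B) \<cdot> a) (pr2 (carr A) (carr B) \<cdot> b)"
proof -
  have "hequiv_rel K D" using D by (simp add: prod_rel_def)
  from related_typed[OF this ab] show
    "related A (pr1 (carr A) (carr B) \<cdot> a) (pr1 (carr A) (carr B) \<cdot> b)"
    "related B (pr2 (carr A) (carr B) \<cdot> a) (pr2 (carr A) (carr B) \<cdot> b)"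
    using D ab unfolding prod_rel_def by simp_all
qed

lemma prod_rel_tup:
  assumes D: "prod_rel A B D" and AB: "hequiv_rel K A" "hequiv_rel K B"
    and a: "related A a a'" and b: "related B b b'" and ab: "src K a = src K b"
  shows "related D (tup a b) (tup a' b')"
  using D related_typed[OF AB(1) a] related_typed[OF AB(2) b] a b ab unfolding prod_rel_def by simp

end


section \<open>Weak homotopy \<open>\<Pi>\<close>-types along product projections\<close>

locale weak_Pi_path_category = plain_path_category K for K :: "('o, 'm) pcat" (structure) +
  assumes weak_Pi: "has_weak_homotopy_Pi K"
begin

text \<open>Pulling back along the projection \<open>I \<times> Y \<rightarrow> I\<close> is taking
  the product with \<open>Y\<close>. This turns the pullbacks in the definition of weak \<Pi>-types
  into chosen products and the pullback of a map \<open>n\<close> into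
  \<open>times_id Y n\<close>.\<close>

lemma pullback_pr1:
  assumes o: "I \<in> obj K" "Y \<in> obj K" and z: "z \<in> arr K" "tgt K z = I"
  shows "pullback K (pr1 I Y) z (prd (src K z) Y) (times_id Y z) (pr1 (src K z) Y)"
  unfolding pullback_def
proof (intro conjI allI impI)
  have oZ: "src K z \<in> obj K" using z src_obj by blast
  show "pr1 I Y \<in> arr K" "z \<in> arr K" "tgt K (pr1 I Y) = tgt K z"
    "times_id Y z \<in> hom K (prd (src K z) Y) (src K (pr1 I Y))"
    "pr1 (src K z) Y \<in> hom K (prd (src K z) Y) (src K z)"
    "pr1 I Y \<cdot> times_id Y z = z \<cdot> pr1 (src K z) Y"
    using o oZ z by (simp_all add: hom_def)
  fix W a b
  assume a: "a \<in> hom K W (src K (pr1 I Y))" and b: "b \<in> hom K W (src K z)" and ab: "pr1 I Y \<cdot> a = z \<cdot> b"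
  have u: "tup b (pr2 I Y \<cdot> a) \<in> hom K W (prd (src K z) Y)"
    "times_id Y z \<cdot> tup b (pr2 I Y \<cdot> a) = a" "pr1 (src K z) Y \<cdot> tup b (pr2 I Y \<cdot> a) = b"
    using a b o oZ z tup_eta[of a I Y] by (simp_all add: hom_def ab)
  show "\<exists>!u. u \<in> hom K W (prd (src K z) Y) \<and> times_id Y z \<cdot> u = a \<and> pr1 (src K z) Y \<cdot> u = b"
  proof (rule ex1I[of _ "tup b (pr2 I Y \<cdot> a)"])
    fix v assume v: "v \<in> hom K W (prd (src K z) Y) \<and> times_id Y z \<cdot> v = a \<and> pr1 (src K z) Y \<cdot> v = b"
    then have va: "v \<in> arr K" "src K v = W" "tgt K v = prd (src K z) Y" by (simp_all add: hom_def)
    have "pr2 I Y \<cdot> a = pr2 I Y \<cdot> (times_id Y z \<cdot> v)" "b = pr1 (src K z) Y \<cdot> v" using v by simp_all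
    then show "v = tup b (pr2 I Y \<cdot> a)" using va z o oZ by simp
  qed (use u in simp)
qed

text \<open>The universal property along a projection, with every pullback replaced by a chosen
  product. The definition provides some cone \<open>A\<close> for the pullback of \<open>e\<close>,
  hence the comparison \<open>i\<close> and the evaluation \<open>ev \<cdot> i\<close>.\<close>

lemma weak_dependent_product:
  assumes o: "I \<in> obj K" "Y \<in> obj K" and f: "f \<in> fib K" "tgt K f = prd I Y"
  obtains e ev where "e \<in> fib K" "tgt K e = I" "ev \<in> hom K (prd (src K e) Y) (src K f)"
    "f \<cdot> ev = times_id Y e"
    "\<forall>z m. z \<in> arr K \<longrightarrow> tgt K z = I \<longrightarrow> m \<in> hom K (prd (src K z) Y) (src K f) \<longrightarrow>
      f \<cdot> m = times_id Y z \<longrightarrow>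
      (\<exists>n \<in> hom K (src K z) (src K e). e \<cdot> n = z \<and> fibrewise_homotopic K f m (ev \<cdot> times_id Y n))"
proof -
  have fa: "f \<in> arr K" using f fibD by blast
  obtain e A a1 a2 ev where W: "weak_homotopy_Pi K f (pr1 I Y) e A a1 a2 ev"
    using weak_Pi f o unfolding has_weak_homotopy_Pi_def by (metis pr_simps(3) pr_simps(8))
  then have e: "e \<in> fib K" "tgt K e = I" and pb: "pullback K (pr1 I Y) e A a1 a2"
    and ev: "ev \<in> hom K A (src K f)" "f \<cdot> ev = a1"
    using o unfolding weak_homotopy_Pi_def by auto
  have ea: "e \<in> arr K" using e fibD by blast
  have oW: "src K e \<in> obj K" using ea src_obj by blast
  note pe = pullback_pr1[OF o ea e(2)]
  note pa = pullbackD[OF pb]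
  obtain i where i: "i \<in> hom K (prd (src K e) Y) A" "a1 \<cdot> i = times_id Y e" "a2 \<cdot> i = pr1 (src K e) Y"
    using pullback_mediate[OF pb, of "times_id Y e" "pr1 (src K e) Y"] o oW ea e by auto
  show thesis
  proof (rule that[of e "ev \<cdot> i"])
    show "ev \<cdot> i \<in> hom K (prd (src K e) Y) (src K f)" using ev i by (simp add: hom_def)
    show "f \<cdot> (ev \<cdot> i) = times_id Y e"
      using cmp_eq_reassoc[OF ev(2), of i] ev(1) i fa by (simp add: hom_def)
  next
    show "\<forall>z m. z \<in> arr K \<longrightarrow> tgt K z = I \<longrightarrow> m \<in> hom K (prd (src K z) Y) (src K f) \<longrightarrow>
      f \<cdot> m = times_id Y z \<longrightarrow> (\<exists>n \<in> hom K (src K z) (src K e).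
        e \<cdot> n = z \<and> fibrewise_homotopic K f m (ev \<cdot> i \<cdot> times_id Y n))"
    proof (intro allI impI)
      fix z m assume z: "z \<in> arr K" "tgt K z = I" and m: "m \<in> hom K (prd (src K z) Y) (src K f)"
        "f \<cdot> m = times_id Y z"
      have oZ: "src K z \<in> obj K" using z src_obj by blast
      obtain n u where n: "n \<in> hom K (src K z) (src K e)" "e \<cdot> n = z"
        and u: "u \<in> hom K (prd (src K z) Y) A" "a1 \<cdot> u = times_id Y z" "a2 \<cdot> u = n \<cdot> pr1 (src K z) Y"
        and hot: "fibrewise_homotopic K f m (ev \<cdot> u)"
        using W pullback_pr1[OF o z] z m o unfolding weak_homotopy_Pi_def by (metis pr_simps(4))
      have na: "n \<in> arr K" "src K n = src K z" "tgt K n = src K e" using n by (simp_all add: hom_def)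
      have ia: "i \<in> arr K" "src K i = prd (src K e) Y" "tgt K i = A" using i by (simp_all add: hom_def)
      \<comment> \<open>The pullback of \<open>n\<close> is determined by its two projections, so it
        must be \<open>n \<times> 1\<close> followed by the comparison.\<close>
      have "u = i \<cdot> times_id Y n"
      proof (rule pullback_joint_mono[OF pb u(1)])
        show "i \<cdot> times_id Y n \<in> hom K (prd (src K z) Y) A"
          using ia na o oZ oW by (simp add: hom_def)
        have "a1 \<cdot> (i \<cdot> times_id Y n) = times_id Y e \<cdot> times_id Y n"
          by (rule cmp_eq_reassoc[OF i(2)]) (use ia na o oZ oW pa in simp_all)
        then show "a1 \<cdot> u = a1 \<cdot> (i \<cdot> times_id Y n)"
          using cmp_eq_reassoc[OF n(2), of "pr1 (src K z) Y"] na ea o oZ oW by (simp add: u(2))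
        have "a2 \<cdot> (i \<cdot> times_id Y n) = pr1 (src K e) Y \<cdot> times_id Y n"
          by (rule cmp_eq_reassoc[OF i(3)]) (use ia na o oZ oW pa in simp_all)
        then show "a2 \<cdot> u = a2 \<cdot> (i \<cdot> times_id Y n)"
          using na o oZ oW by (simp add: u(3))
      qed
      then have "ev \<cdot> u = ev \<cdot> i \<cdot> times_id Y n" using ev(1) ia na o oZ oW by (simp add: hom_def)
      then show "\<exists>n \<in> hom K (src K z) (src K e).
          e \<cdot> n = z \<and> fibrewise_homotopic K f m (ev \<cdot> i \<cdot> times_id Y n)"
        using n hot by (intro bexI[of _ n]) simp_all
    qed
  qed (use e in simp_all)
qed

text \<open>Universal quantification over \<open>Y\<close> is exact even though the \<Pi>-type is
  weak. Evaluation turns a lift of \<open>z\<close> into a lift of \<open>z \<times> 1\<close>;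
  currying a lift \<open>m\<close> gives \<open>n\<close> with \<open>e \<cdot> n = z\<close> on the
  nose, and it does not matter which lift \<open>n\<close> is.\<close>

lemma lifts_forall:
  assumes o: "I \<in> obj K" "Y \<in> obj K" and f: "f \<in> fib K" "tgt K f = prd I Y"
  obtains e where "e \<in> fib K" "tgt K e = I"
    "\<And>z. z \<in> arr K \<Longrightarrow> tgt K z = I \<Longrightarrow> lifts e z \<longleftrightarrow> lifts f (times_id Y z)"
proof -
  have fa: "f \<in> arr K" using f fibD by blast
  obtain e ev where e: "e \<in> fib K" "tgt K e = I" and ev: "ev \<in> hom K (prd (src K e) Y) (src K f)"
      "f \<cdot> ev = times_id Y e"
    and univ: "\<forall>z m. z \<in> arr K \<longrightarrow> tgt K z = I \<longrightarrow> m \<in> hom K (prd (src K z) Y) (src K f) \<longrightarrow>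
      f \<cdot> m = times_id Y z \<longrightarrow>
      (\<exists>n \<in> hom K (src K z) (src K e). e \<cdot> n = z \<and> fibrewise_homotopic K f m (ev \<cdot> times_id Y n))"
    using weak_dependent_product[OF o f] .
  have ea: "e \<in> arr K" using e fibD by blast
  have oW: "src K e \<in> obj K" using ea src_obj by blast
  have "lifts e z \<longleftrightarrow> lifts f (times_id Y z)" if z: "z \<in> arr K" "tgt K z = I" for z
  proof
    have oZ: "src K z \<in> obj K" using z src_obj by blast
    {
      assume "lifts e z"
      then obtain h where h: "h \<in> arr K" "tgt K h = src K e" "e \<cdot> h = z" by (auto simp: lifts_def)
      have hs: "src K h = src K z" using h ea by auto
      have "f \<cdot> (ev \<cdot> times_id Y h) = times_id Y e \<cdot> times_id Y h"
        by (rule cmp_eq_reassoc[OF ev(2)]) (use ev(1) h(1,2) fa hs o oZ oW in \<open>simp_all add: hom_def\<close>)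
      also have "\<dots> = times_id Y z"
        using cmp_eq_reassoc[OF h(3), of "pr1 (src K z) Y"] h(1,2) hs ea o oZ oW by simp
      finally show "lifts f (times_id Y z)"
        unfolding lifts_def using ev(1) h(1,2) hs o oZ oW
        by (intro bexI[of _ "ev \<cdot> times_id Y h"]) (simp_all add: hom_def)
    }
    assume "lifts f (times_id Y z)"
    then obtain m where m: "m \<in> arr K" "tgt K m = src K f" "f \<cdot> m = times_id Y z"
      by (auto simp: lifts_def)
    have "src K m = src K (f \<cdot> m)" using m(1,2) fa by simp
    then have "src K m = prd (src K z) Y" using z o oZ by (simp add: m(3))
    then show "lifts e z"
      using univ[rule_format, OF z, of m] m by (auto simp: lifts_def hom_def)
  qed
  then show thesis using that e by blast
qed

text \<open>The object \<open>W\<close> is the weak \<Pi>-type, along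
  \<open>T \<times> Y \<rightarrow> T\<close> with \<open>T\<close> terminal, of the constant family
  \<open>X \<times> (T \<times> Y)\<close>. One \<open>n\<close> serves all equivalence relations on
  \<open>X\<close>, because homotopic maps are related in each of them.\<close>

lemma weak_exponential:
  assumes o: "X \<in> obj K" "Y \<in> obj K"
  obtains W ev where "W \<in> obj K" "ev \<in> hom K (prd W Y) X"
    "\<And>Z m. Z \<in> obj K \<Longrightarrow> m \<in> hom K (prd Z Y) X \<Longrightarrow> \<exists>n \<in> hom K Z W.
      \<forall>A. hequiv_rel K A \<longrightarrow> carr A = X \<longrightarrow> related A m (ev \<cdot> times_id Y n)"
proof -
  obtain T where T: "terminal K T" using terminal_ex by blast
  then have oT: "T \<in> obj K" by (simp add: terminal_def)
  let ?I = "prd T Y"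
  have f: "pr2 X ?I \<in> fib K" "tgt K (pr2 X ?I) = ?I" using o oT by simp_all
  obtain e ev where e: "e \<in> fib K" "tgt K e = T"
    and ev: "ev \<in> hom K (prd (src K e) Y) (src K (pr2 X ?I))" "pr2 X ?I \<cdot> ev = times_id Y e"
    and univ: "\<forall>z m. z \<in> arr K \<longrightarrow> tgt K z = T \<longrightarrow>
      m \<in> hom K (prd (src K z) Y) (src K (pr2 X ?I)) \<longrightarrow> pr2 X ?I \<cdot> m = times_id Y z \<longrightarrow>
      (\<exists>n \<in> hom K (src K z) (src K e). e \<cdot> n = z \<and>
        fibrewise_homotopic K (pr2 X ?I) m (ev \<cdot> times_id Y n))"
    using weak_dependent_product[OF oT o(2) f] .
  have oW: "src K e \<in> obj K" using e fibD src_obj by blast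
  show thesis
  proof (rule that[OF oW, of "pr1 X ?I \<cdot> ev"])
    show "pr1 X ?I \<cdot> ev \<in> hom K (prd (src K e) Y) X" using ev o oT by (simp add: hom_def)
    fix Z m assume Z: "Z \<in> obj K" and m: "m \<in> hom K (prd Z Y) X"
    obtain z where z: "z \<in> hom K Z T" using T Z unfolding terminal_def by blast
    \<comment> \<open>A map into the constant family is a pair, and lying over
      \<open>T \<times> Y\<close> forces its second component.\<close>
    let ?m = "tup m (times_id Y z)"
    have "\<exists>n \<in> hom K (src K z) (src K e). e \<cdot> n = z \<and>
        fibrewise_homotopic K (pr2 X ?I) ?m (ev \<cdot> times_id Y n)"
      by (rule univ[rule_format]) (use z m Z o oT in \<open>simp_all add: hom_def\<close>)
    then obtain n where n: "n \<in> hom K Z (src K e)"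
      and hot: "fibrewise_homotopic K (pr2 X ?I) ?m (ev \<cdot> times_id Y n)"
      using z by (auto simp: hom_def)
    have "related A m (pr1 X ?I \<cdot> ev \<cdot> times_id Y n)" if A: "hequiv_rel K A" "carr A = X" for A
      using fibrewise_homotopic_related[OF A(1) hot, of "pr1 X ?I"] A(2) z m n ev(1) Z o oT oW
      by (simp add: hom_def)
    with n show "\<exists>n \<in> hom K Z (src K e). \<forall>A. hequiv_rel K A \<longrightarrow> carr A = X \<longrightarrow>
        related A m (pr1 X ?I \<cdot> ev \<cdot> times_id Y n)" by blast
  qed
qed

text \<open>The common core of both kinds of exponential. Existence and uniqueness of curryings are
  phrased with \<open>related\<close>, into which both the homotopy relation of the exact completion
  and the equality of morphism classes translate.\<close>

lemma exponential_relation: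
  assumes X: "hequiv_rel K X" and Y: "hequiv_rel K Y"
  obtains E D ev where "hequiv_rel K E" "prod_rel E Y D" "ev \<in> ex_maps K D X"
    "\<forall>A Q h. hequiv_rel K A \<longrightarrow> prod_rel A Y Q \<longrightarrow> h \<in> ex_maps K Q X \<longrightarrow>
      (\<exists>H \<in> ex_maps K A E. related X (ev \<cdot> times_id (carr Y) H) h)"
    "\<forall>H H' Z. H \<in> hom K Z (carr E) \<longrightarrow> H' \<in> hom K Z (carr E) \<longrightarrow>
      related X (ev \<cdot> times_id (carr Y) H) (ev \<cdot> times_id (carr Y) H') \<longrightarrow> related E H H'"
proof -
  define X0 Y0 S s1 s2 where XY: "X0 = carr X" "Y0 = carr Y" "S = rel Y" "s1 = leg1 Y" "s2 = leg2 Y"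
  have s: "s1 \<in> arr K" "src K s1 = S" "tgt K s1 = Y0" "s2 \<in> arr K" "src K s2 = S" "tgt K s2 = Y0"
    using hequiv_rel_legs[OF Y] by (simp_all add: XY)
  have o: "X0 \<in> obj K" "Y0 \<in> obj K" using hequiv_rel_carr X Y by (simp_all add: XY)
  have oS: "S \<in> obj K" using src_obj[of s1] s by simp
  have s12: "related Y s1 s2" using related_legs[OF Y] by (simp add: XY)
  obtain W w where oW: "W \<in> obj K" and w: "w \<in> hom K (prd W Y0) X0"
    and Wuniv: "\<And>Z m. Z \<in> obj K \<Longrightarrow> m \<in> hom K (prd Z Y0) X0 \<Longrightarrow> \<exists>n \<in> hom K Z W.
      \<forall>A. hequiv_rel K A \<longrightarrow> carr A = X0 \<longrightarrow> related A m (w \<cdot> times_id Y0 n)"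
    by (rule weak_exponential[OF o]) blast
  have wa: "w \<in> arr K" "src K w = prd W Y0" "tgt K w = X0" using w by (simp_all add: hom_def)
  \<comment> \<open>\<open>g\<close> compares the values of \<open>w\<close> at the two legs of the
    relation on \<open>Y\<close>. Quantifying over \<open>S\<close> then covers all related pairs of
    arguments, since each of them factors through the legs.\<close>
  obtain g where g: "g \<in> fib K" "tgt K g = prd W S"
    and gl: "\<And>z. z \<in> arr K \<Longrightarrow> tgt K z = prd W S \<Longrightarrow> lifts g z \<longleftrightarrow>
      related X (w \<cdot> tup (pr1 W S \<cdot> z) (s1 \<cdot> (pr2 W S \<cdot> z))) (w \<cdot> tup (pr1 W S \<cdot> z) (s2 \<cdot> (pr2 W S \<cdot> z)))"
    by (rule related_preimage_fibration[OF X, of "w \<cdot> tup (pr1 W S) (s1 \<cdot> pr2 W S)"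
          "w \<cdot> tup (pr1 W S) (s2 \<cdot> pr2 W S)"])
      (use wa s o oS oW in \<open>simp_all add: XY(1)[symmetric]\<close>)
  obtain e where e: "e \<in> fib K" "tgt K e = W"
    and el': "\<And>z. z \<in> arr K \<Longrightarrow> tgt K z = W \<Longrightarrow> lifts e z \<longleftrightarrow> lifts g (times_id S z)"
    using lifts_forall[OF oW oS g] by metis
  have el: "lifts e z \<longleftrightarrow>
      related X (w \<cdot> tup (z \<cdot> pr1 (src K z) S) (s1 \<cdot> pr2 (src K z) S))
        (w \<cdot> tup (z \<cdot> pr1 (src K z) S) (s2 \<cdot> pr2 (src K z) S))"
    if z: "z \<in> arr K" "tgt K z = W" for z
    using el'[OF z] gl[of "times_id S z"] z oS oW src_obj[OF z(1)] by simp
  define E0 where "E0 = src K e"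
  have ea: "e \<in> arr K" "src K e = E0" "tgt K e = W" "E0 \<in> obj K"
    using e fibD src_obj by (auto simp: E0_def)
  define ev where "ev = w \<cdot> times_id Y0 e"
  have ev: "ev \<in> arr K" "src K ev = prd E0 Y0" "tgt K ev = X0"
    using wa ea o oW by (simp_all add: ev_def)
  have ev_tup: "ev \<cdot> tup h y = w \<cdot> tup (e \<cdot> h) y"
    if "h \<in> arr K" "tgt K h = E0" "y \<in> arr K" "tgt K y = Y0" "src K h = src K y" for h y
    using that wa ea o oW by (simp add: ev_def)
  \<comment> \<open>An element of \<open>E0\<close> carries a proof of compatibility for the generic
    related pair; precomposing it with the map \<open>k\<close> that names the given pair
    specialises it to \<open>y\<close> and \<open>y'\<close>.\<close>
  have ev_tracked: "related X (ev \<cdot> tup h y) (ev \<cdot> tup h y')"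
    if h: "h \<in> arr K" "tgt K h = E0" and y: "related Y y y'" "src K y = src K h" for h y y'
  proof -
    note yt = related_typed[OF Y y(1), folded XY]
    obtain k where k: "k \<in> arr K" "tgt K k = S" "s1 \<cdot> k = y" "s2 \<cdot> k = y'"
      using y(1) by (rule relatedE) (simp add: XY)
    have ks: "src K k = src K h" using k(1-3) s y(2) by (metis cmp_arr(2))
    have oZ: "src K h \<in> obj K" using h src_obj by blast
    have "lifts e (e \<cdot> h)" unfolding lifts_def using h ea by (intro bexI[of _ h]) simp_all
    then have "related X (w \<cdot> tup (e \<cdot> h \<cdot> pr1 (src K h) S) (s1 \<cdot> pr2 (src K h) S))
        (w \<cdot> tup (e \<cdot> h \<cdot> pr1 (src K h) S) (s2 \<cdot> pr2 (src K h) S))"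
      using el[of "e \<cdot> h"] h ea by simp
    from related_cmp[OF X this, of "tup (ident K (src K h)) k"]
    have "related X (w \<cdot> tup (e \<cdot> h) (s1 \<cdot> k)) (w \<cdot> tup (e \<cdot> h) (s2 \<cdot> k))"
      using h ea k(1,2) ks wa s o oS oW oZ by simp
    then show ?thesis using ev_tup h yt y(2) by (simp add: k(3,4))
  qed
  let ?EE = "prd E0 E0"
  \<comment> \<open>\<open>f\<close> says that two elements of \<open>E0\<close> have related values
    at one common argument, and \<open>t\<close> quantifies over that argument. A common argument
    suffices because compatibility in the argument is built into \<open>E0\<close>.\<close>
  obtain f where f: "f \<in> fib K" "tgt K f = prd ?EE Y0"
    and fl: "\<And>z. z \<in> arr K \<Longrightarrow> tgt K z = prd ?EE Y0 \<Longrightarrow> lifts f z \<longleftrightarrow>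
      related X (ev \<cdot> tup (pr1 E0 E0 \<cdot> (pr1 ?EE Y0 \<cdot> z)) (pr2 ?EE Y0 \<cdot> z))
        (ev \<cdot> tup (pr2 E0 E0 \<cdot> (pr1 ?EE Y0 \<cdot> z)) (pr2 ?EE Y0 \<cdot> z))"
    by (rule related_preimage_fibration[OF X, of "ev \<cdot> tup (pr1 E0 E0 \<cdot> pr1 ?EE Y0) (pr2 ?EE Y0)"
          "ev \<cdot> tup (pr2 E0 E0 \<cdot> pr1 ?EE Y0) (pr2 ?EE Y0)"])
      (use ev ea o in \<open>simp_all add: XY(1)[symmetric]\<close>)
  have oEE: "?EE \<in> obj K" using ea by simp
  obtain t where t: "t \<in> fib K" "tgt K t = ?EE"
    and tl: "\<And>z. z \<in> arr K \<Longrightarrow> tgt K z = ?EE \<Longrightarrow> lifts t z \<longleftrightarrow> lifts f (times_id Y0 z)"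
    using lifts_forall[OF oEE o(2) f] by metis
  let ?E = "\<lambda>a b. related X (ev \<cdot> times_id Y0 a) (ev \<cdot> times_id Y0 b)"
  have "\<exists>E. hequiv_rel K E \<and> carr E = E0 \<and> (\<forall>a b. a \<in> arr K \<longrightarrow> b \<in> arr K \<longrightarrow> src K a = src K b \<longrightarrow>
      tgt K a = E0 \<longrightarrow> tgt K b = E0 \<longrightarrow> (related E a b \<longleftrightarrow> ?E a b))"
  proof (rule hequiv_rel_of_fibration[OF ea(4) t, of ?E])
    fix a b assume ab: "a \<in> arr K" "b \<in> arr K" "src K a = src K b" "tgt K a = E0" "tgt K b = E0"
    have "src K b \<in> obj K" using ab src_obj by blast
    then show "lifts t (tup a b) \<longleftrightarrow> ?E a b"
      using tl[of "tup a b"] fl[of "times_id Y0 (tup a b)"] ab ea o by simp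
  next
    fix a assume a: "a \<in> arr K" "tgt K a = E0"
    then have "src K a \<in> obj K" using src_obj by blast
    then show "?E a a" using related_refl[OF X, of "ev \<cdot> times_id Y0 a"] a ev ea o by (simp add: XY)
  qed (use related_sym[OF X] related_trans[OF X] in blast)+
  then obtain E where E: "hequiv_rel K E" "carr E = E0"
    and Erel: "\<And>a b. a \<in> arr K \<Longrightarrow> b \<in> arr K \<Longrightarrow> src K a = src K b \<Longrightarrow> tgt K a = E0 \<Longrightarrow> tgt K b = E0 \<Longrightarrow>
      related E a b \<longleftrightarrow> ?E a b" by blast
  obtain D where D: "prod_rel E Y D" using prod_rel_ex[OF E(1) Y] .
  have D': "hequiv_rel K D" "carr D = prd E0 Y0" using D E by (simp_all add: prod_rel_def XY)
  show thesis
  proof (rule that[OF E(1) D])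
    show "ev \<in> ex_maps K D X"
      unfolding ex_maps_iff[OF D'(1) X]
    proof (intro conjI allI impI)
      show "ev \<in> hom K (carr D) (carr X)" using ev D' by (simp add: hom_def XY)
      fix a b assume ab: "related D a b"
      note abt = related_typed[OF D'(1) ab, unfolded D'(2)]
      have oZ: "src K b \<in> obj K" using abt src_obj by blast
      have r: "related E (pr1 E0 Y0 \<cdot> a) (pr1 E0 Y0 \<cdot> b)" "related Y (pr2 E0 Y0 \<cdot> a) (pr2 E0 Y0 \<cdot> b)"
        using prod_relD[OF D ab] E by (simp_all add: XY)
      then have "?E (pr1 E0 Y0 \<cdot> a) (pr1 E0 Y0 \<cdot> b)" using Erel abt ea o by simp
      \<comment> \<open>Relatedness in \<open>E\<close> speaks of the generic argument; pairing the
        identity with the actual argument specialises it. The function is changed here and the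
        argument afterwards by \<open>ev_tracked\<close>; transitivity joins the two.\<close>
      from related_cmp[OF X this, of "tup (ident K (src K b)) (pr2 E0 Y0 \<cdot> a)"]
      have "related X (ev \<cdot> tup (pr1 E0 Y0 \<cdot> a) (pr2 E0 Y0 \<cdot> a)) (ev \<cdot> tup (pr1 E0 Y0 \<cdot> b) (pr2 E0 Y0 \<cdot> a))"
        using abt ev ea o oZ by (simp del: tup_eta)
      moreover have "related X (ev \<cdot> tup (pr1 E0 Y0 \<cdot> b) (pr2 E0 Y0 \<cdot> a)) (ev \<cdot> tup (pr1 E0 Y0 \<cdot> b) (pr2 E0 Y0 \<cdot> b))"
        by (rule ev_tracked) (use r abt ea o in simp_all)
      ultimately show "related X (ev \<cdot> a) (ev \<cdot> b)"
        using related_trans[OF X] abt ea o by simp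
    qed
    show "\<forall>H H' Z. H \<in> hom K Z (carr E) \<longrightarrow> H' \<in> hom K Z (carr E) \<longrightarrow>
      related X (ev \<cdot> times_id (carr Y) H) (ev \<cdot> times_id (carr Y) H') \<longrightarrow> related E H H'"
      using Erel E by (simp add: hom_def XY)
    show "\<forall>A Q h. hequiv_rel K A \<longrightarrow> prod_rel A Y Q \<longrightarrow> h \<in> ex_maps K Q X \<longrightarrow>
      (\<exists>H \<in> ex_maps K A E. related X (ev \<cdot> times_id (carr Y) H) h)"
    proof (intro allI impI)
      fix A Q h assume A: "hequiv_rel K A" and Q: "prod_rel A Y Q" and "h \<in> ex_maps K Q X"
      define A0 where "A0 = carr A"
      have oA: "A0 \<in> obj K" using hequiv_rel_carr[OF A] by (simp add: A0_def)
      have Q': "hequiv_rel K Q" "carr Q = prd A0 Y0" using Q by (simp_all add: prod_rel_def XY A0_def)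
      have h: "h \<in> arr K" "src K h = prd A0 Y0" "tgt K h = X0"
        and h_rel: "\<And>a b. related Q a b \<Longrightarrow> related X (h \<cdot> a) (h \<cdot> b)"
        using \<open>h \<in> ex_maps K Q X\<close> Q' unfolding ex_maps_iff[OF Q'(1) X] by (simp_all add: hom_def XY)
      obtain n where n: "n \<in> hom K A0 W" and "related X h (w \<cdot> times_id Y0 n)"
        using Wuniv[OF oA, of h] h X by (auto simp: hom_def XY)
      then have na: "n \<in> arr K" "src K n = A0" "tgt K n = W" by (simp_all add: hom_def)
      have hn: "related X h (w \<cdot> tup (n \<cdot> pr1 A0 Y0) (pr2 A0 Y0))"
        using \<open>related X h (w \<cdot> times_id Y0 n)\<close> na by simp
      have hn_tup: "related X (h \<cdot> tup a y) (w \<cdot> tup (n \<cdot> a) y)"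
        if "a \<in> arr K" "tgt K a = A0" "y \<in> arr K" "tgt K y = Y0" "src K a = src K y" for a y
        using related_cmp[OF X hn, of "tup a y"] that na wa h o oA oW by simp
      \<comment> \<open>Compatibility of \<open>n\<close> is inherited from the tracked map
        \<open>h\<close>, since the values of \<open>w\<close> on both sides are related to the
        corresponding values of \<open>h\<close>.\<close>
      have wn: "related X (w \<cdot> tup (n \<cdot> a) y) (w \<cdot> tup (n \<cdot> a') y')"
        if a: "related A a a'" and y: "related Y y y'" and ay: "src K a = src K y" for a a' y y'
      proof -
        note at = related_typed[OF A a, folded A0_def] and yt = related_typed[OF Y y, folded XY]
        have "related X (h \<cdot> tup a y) (h \<cdot> tup a' y')"
          by (rule h_rel) (use prod_rel_tup[OF Q A Y a y ay] in simp)
        then show ?thesis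
          using hn_tup[of a y] hn_tup[of a' y'] at yt ay related_sym[OF X] related_trans[OF X] by metis
      qed
      \<comment> \<open>At the generic related pair of arguments, \<open>wn\<close> is the predicate
        represented by \<open>e\<close>.\<close>
      have "lifts e n"
        unfolding el[OF na(1,3)] na
        by (rule wn) (use related_refl[OF A, of "pr1 A0 S"] related_cmp[OF Y s12, of "pr2 A0 S"] s oA oS
          in \<open>simp_all add: A0_def[symmetric]\<close>)
      then obtain H where H: "H \<in> arr K" "tgt K H = E0" "e \<cdot> H = n" by (auto simp: lifts_def ea)
      have HA: "src K H = A0" using H ea na by (metis cmp_arr(2))
      \<comment> \<open>Because \<open>e \<cdot> H = n\<close> is strict, \<open>H\<close> evaluates
        exactly as \<open>n\<close> does, so only the original error between \<open>w\<close> and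
        \<open>h\<close> remains.\<close>
      have evH: "ev \<cdot> times_id Y0 H = w \<cdot> times_id Y0 n"
        using ev_tup[of "H \<cdot> pr1 A0 Y0" "pr2 A0 Y0"] cmp_eq_reassoc[OF H(3), of "pr1 A0 Y0"] H(1,2) HA na ea o oA
        by simp
      have "H \<in> ex_maps K A E"
        unfolding ex_maps_iff[OF A E(1)]
      proof (intro conjI allI impI)
        show "H \<in> hom K (carr A) (carr E)" using H HA E by (simp add: hom_def A0_def)
        fix a b assume ab: "related A a b"
        note abt = related_typed[OF A ab, folded A0_def]
        let ?Z = "src K b"
        have oZ: "?Z \<in> obj K" using abt src_obj by blast
        have "related X (w \<cdot> tup (n \<cdot> (a \<cdot> pr1 ?Z Y0)) (pr2 ?Z Y0)) (w \<cdot> tup (n \<cdot> (b \<cdot> pr1 ?Z Y0)) (pr2 ?Z Y0))"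
          by (rule wn) (use related_cmp[OF A ab, of "pr1 ?Z Y0"] related_refl[OF Y, of "pr2 ?Z Y0"] abt o oZ
            in \<open>simp_all add: XY(2)[symmetric]\<close>)
        then have "?E (H \<cdot> a) (H \<cdot> b)"
          using ev_tup[of "H \<cdot> (a \<cdot> pr1 ?Z Y0)" "pr2 ?Z Y0"] ev_tup[of "H \<cdot> (b \<cdot> pr1 ?Z Y0)" "pr2 ?Z Y0"]
            cmp_eq_reassoc[OF H(3), of "a \<cdot> pr1 ?Z Y0"] cmp_eq_reassoc[OF H(3), of "b \<cdot> pr1 ?Z Y0"]
            H(1,2) HA abt ea o oZ by simp
        then show "related E (H \<cdot> a) (H \<cdot> b)" using Erel H HA abt by simp
      qed
      moreover have "related X (ev \<cdot> times_id (carr Y) H) h"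
        using evH related_sym[OF X \<open>related X h (w \<cdot> times_id Y0 n)\<close>] by (simp add: XY)
      ultimately show "\<exists>H \<in> ex_maps K A E. related X (ev \<cdot> times_id (carr Y) H) h" by blast
    qed
  qed
qed

end

section \<open>The exact completion\<close>

context plain_path_category
begin

section \<open>Morphisms, products and homotopies in the exact completion\<close>

lemma ident_ex_map:
  assumes "hequiv_rel K A"
  shows "ident K (carr A) \<in> ex_maps K A A"
  using assms hequiv_rel_carr[OF assms] related_typed[OF assms]
  by (simp add: ex_maps_iff hom_def)

lemma cmp_ex_map:
  assumes "hequiv_rel K A" "hequiv_rel K B" "hequiv_rel K D"
    and "f \<in> ex_maps K A B" "g \<in> ex_maps K B D"
  shows "g \<cdot> f \<in> ex_maps K A D"
proof -
  have fg: "f \<in> hom K (carr A) (carr B)" "\<And>a b. related A a b \<Longrightarrow> related B (f \<cdot> a) (f \<cdot> b)"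
    "g \<in> hom K (carr B) (carr D)" "\<And>a b. related B a b \<Longrightarrow> related D (g \<cdot> a) (g \<cdot> b)"
    using assms by (simp_all add: ex_maps_iff)
  have "related D (g \<cdot> f \<cdot> a) (g \<cdot> f \<cdot> b)" if "related A a b" for a b
    using fg(4)[OF fg(2)[OF that]] related_typed[OF assms(1) that] fg(1,3) by (simp add: hom_def)
  then show ?thesis using cmp_hom[OF fg(1,3)] assms by (simp add: ex_maps_iff)
qed

lemma ex_mapD:
  assumes "f \<in> ex_maps K A B"
  shows "f \<in> arr K" "src K f = carr A" "tgt K f = carr B"
  using assms by (simp_all add: ex_maps_def hom_def)

lemma ex_map_related:
  "f \<in> ex_maps K A B \<Longrightarrow> hequiv_rel K A \<Longrightarrow> hequiv_rel K B \<Longrightarrow> related A a b \<Longrightarrow> related B (f \<cdot> a) (f \<cdot> b)"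
  by (simp add: ex_maps_iff)

lemma prod_rel_pr_ex_maps:
  assumes D: "prod_rel A B D" and AB: "hequiv_rel K A" "hequiv_rel K B"
  shows "pr1 (carr A) (carr B) \<in> ex_maps K D A" "pr2 (carr A) (carr B) \<in> ex_maps K D B"
  using D AB hequiv_rel_carr[OF AB(1)] hequiv_rel_carr[OF AB(2)] prod_relD[OF D]
  by (simp_all add: ex_maps_iff hom_def prod_rel_def)

lemma tup_ex_map:
  assumes D: "prod_rel A B D" and AB: "hequiv_rel K A" "hequiv_rel K B" "hequiv_rel K Z"
    and f: "f \<in> ex_maps K Z A" and g: "g \<in> ex_maps K Z B"
  shows "tup f g \<in> ex_maps K Z D"
proof -
  note f' = ex_mapD[OF f] and g' = ex_mapD[OF g]
  have D': "hequiv_rel K D" "carr D = prd (carr A) (carr B)" using D by (simp_all add: prod_rel_def)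
  have "related D (tup f g \<cdot> a) (tup f g \<cdot> b)" if ab: "related Z a b" for a b
    using prod_rel_tup[OF D AB(1,2) ex_map_related[OF f AB(3,1) ab] ex_map_related[OF g AB(3,2) ab]]
      related_typed[OF AB(3) ab] f' g' by simp
  then show ?thesis using f' g' D' AB by (simp add: ex_maps_iff hom_def)
qed

lemma times_id_ex_map:
  assumes Q: "prod_rel A Y Q" and D: "prod_rel E Y D"
    and A: "hequiv_rel K A" and E: "hequiv_rel K E" and Y: "hequiv_rel K Y" and H: "H \<in> ex_maps K A E"
  shows "times_id (carr Y) H \<in> ex_maps K Q D"
proof -
  have Q': "hequiv_rel K Q" using Q by (simp add: prod_rel_def)
  show ?thesis unfolding ex_mapD[OF H]
    by (intro tup_ex_map[OF D E Y Q'] cmp_ex_map[OF Q' A E] prod_rel_pr_ex_maps[OF Q A Y] H)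
qed

lemma related_prod_rel_iff:
  assumes D: "prod_rel A B D" and u: "u \<in> ex_maps K Z D" and v: "v \<in> ex_maps K Z D"
  shows "related D u v \<longleftrightarrow> related A (pr1 (carr A) (carr B) \<cdot> u) (pr1 (carr A) (carr B) \<cdot> v) \<and>
    related B (pr2 (carr A) (carr B) \<cdot> u) (pr2 (carr A) (carr B) \<cdot> v)"
  using D ex_mapD[OF u] ex_mapD[OF v] by (simp add: prod_rel_def)

lemma Ex_simps:
  "obj (Ex_cat K) = {A. hequiv_rel K A}"
  "src (Ex_cat K) = dsrc" "tgt (Ex_cat K) = dtgt"
  "ident (Ex_cat K) A = Darr A (ident K (carr A)) A"
  "Darr B g D \<cdot>\<^bsub>Ex_cat K\<^esub> Darr A f B' = Darr A (g \<cdot> f) D"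
  "F \<in> arr (Ex_cat K) \<longleftrightarrow> hequiv_rel K (dsrc F) \<and> hequiv_rel K (dtgt F) \<and>
    umap F \<in> ex_maps K (dsrc F) (dtgt F)"
  "F \<in> fib (Ex_cat K) \<longleftrightarrow> F \<in> arr (Ex_cat K) \<and> ex_fibration K (dsrc F) (dtgt F) (umap F)"
  "F \<in> weq (Ex_cat K) \<longleftrightarrow> F \<in> arr (Ex_cat K) \<and> ex_weak_equivalence K (dsrc F) (dtgt F) (umap F)"
  by (cases F; auto simp: Ex_cat_def Let_def)+

lemma hom_Ex:
  "F \<in> hom (Ex_cat K) A B \<longleftrightarrow> hequiv_rel K A \<and> hequiv_rel K B \<and> (\<exists>f \<in> ex_maps K A B. F = Darr A f B)"
  by (cases F) (auto simp: hom_def Ex_simps)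

lemma category_Ex: "category (Ex_cat K)"
proof
  show "F \<cdot>\<^bsub>Ex_cat K\<^esub> ident (Ex_cat K) A = F" "ident (Ex_cat K) B \<cdot>\<^bsub>Ex_cat K\<^esub> F = F"
    if F: "F \<in> hom (Ex_cat K) A B" for F A B
  proof -
    obtain f where "F = Darr A f B" "f \<in> ex_maps K A B" using F unfolding hom_Ex by blast
    then show "F \<cdot>\<^bsub>Ex_cat K\<^esub> ident (Ex_cat K) A = F" "ident (Ex_cat K) B \<cdot>\<^bsub>Ex_cat K\<^esub> F = F"
      using ex_mapD[of f A B] by (simp_all add: Ex_simps)
  qed
  show "H \<cdot>\<^bsub>Ex_cat K\<^esub> (G \<cdot>\<^bsub>Ex_cat K\<^esub> F) = (H \<cdot>\<^bsub>Ex_cat K\<^esub> G) \<cdot>\<^bsub>Ex_cat K\<^esub> F"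
    if F: "F \<in> hom (Ex_cat K) A B" and G: "G \<in> hom (Ex_cat K) B C" and H: "H \<in> hom (Ex_cat K) C D"
    for F G H A B C D
  proof -
    obtain f g h where "F = Darr A f B" "G = Darr B g C" "H = Darr C h D"
      "f \<in> ex_maps K A B" "g \<in> ex_maps K B C" "h \<in> ex_maps K C D"
      using F G H unfolding hom_Ex by blast
    then show ?thesis using ex_mapD[of f A B] ex_mapD[of g B C] ex_mapD[of h C D] by (simp add: Ex_simps)
  qed
qed (auto simp: hom_Ex Ex_simps intro: ident_ex_map cmp_ex_map)

text \<open>Morphisms are actual maps here, so strict uniqueness of the mediating map is inherited
  from the chosen product of the carriers.\<close>

lemma product_Ex:
  assumes D: "prod_rel A B D" and A: "hequiv_rel K A" and B: "hequiv_rel K B"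
  shows "product (Ex_cat K) A B D (Darr D (pr1 (carr A) (carr B)) A) (Darr D (pr2 (carr A) (carr B)) B)"
  unfolding product_def
proof (intro conjI allI impI)
  note pr = prod_rel_pr_ex_maps[OF D A B]
  have D': "hequiv_rel K D" "carr D = prd (carr A) (carr B)" using D by (simp_all add: prod_rel_def)
  have o: "carr A \<in> obj K" "carr B \<in> obj K" using A B hequiv_rel_carr by blast+
  show "Darr D (pr1 (carr A) (carr B)) A \<in> hom (Ex_cat K) D A"
    "Darr D (pr2 (carr A) (carr B)) B \<in> hom (Ex_cat K) D B"
    using pr D' A B by (simp_all add: hom_Ex)
  fix Z F G assume "F \<in> hom (Ex_cat K) Z A" "G \<in> hom (Ex_cat K) Z B"
  then obtain f g where F: "F = Darr Z f A" and G: "G = Darr Z g B" and Z: "hequiv_rel K Z"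
    and f: "f \<in> ex_maps K Z A" and g: "g \<in> ex_maps K Z B" unfolding hom_Ex by blast
  note f' = ex_mapD[OF f] and g' = ex_mapD[OF g]
  show "\<exists>!u. u \<in> hom (Ex_cat K) Z D \<and> Darr D (pr1 (carr A) (carr B)) A \<cdot>\<^bsub>Ex_cat K\<^esub> u = F \<and>
      Darr D (pr2 (carr A) (carr B)) B \<cdot>\<^bsub>Ex_cat K\<^esub> u = G"
  proof (rule ex1I[of _ "Darr Z (tup f g) D"])
    show "Darr Z (tup f g) D \<in> hom (Ex_cat K) Z D \<and>
      Darr D (pr1 (carr A) (carr B)) A \<cdot>\<^bsub>Ex_cat K\<^esub> Darr Z (tup f g) D = F \<and>
      Darr D (pr2 (carr A) (carr B)) B \<cdot>\<^bsub>Ex_cat K\<^esub> Darr Z (tup f g) D = G"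
      using tup_ex_map[OF D A B Z f g] f' g' Z D' by (simp add: hom_Ex Ex_simps F G)
    fix U assume "U \<in> hom (Ex_cat K) Z D \<and> Darr D (pr1 (carr A) (carr B)) A \<cdot>\<^bsub>Ex_cat K\<^esub> U = F \<and>
      Darr D (pr2 (carr A) (carr B)) B \<cdot>\<^bsub>Ex_cat K\<^esub> U = G"
    then obtain u where U: "U = Darr Z u D" and u: "u \<in> ex_maps K Z D"
      "pr1 (carr A) (carr B) \<cdot> u = f" "pr2 (carr A) (carr B) \<cdot> u = g"
      by (auto simp: hom_Ex Ex_simps F G)
    have "tup (pr1 (carr A) (carr B) \<cdot> u) (pr2 (carr A) (carr B) \<cdot> u) = u"
      by (rule tup_eta) (use ex_mapD[OF u(1)] D' o in simp_all)
    then show "U = Darr Z (tup f g) D" by (simp add: U u(2,3))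
  qed
qed

text \<open>Two elements of \<open>rel B\<close> count as related when both their endpoints are. The
  first leg is a homotopy inverse of the reflexivity map \<open>r\<close>: both endpoints of
  \<open>r \<cdot> leg1 B\<close> are the first leg, which is related to itself and to the second
  leg.\<close>

lemma rel_path_object:
  assumes B: "hequiv_rel K B"
  obtains D r where "path_object (Ex_cat K) B D (Darr B r D) (Darr D (leg1 B) B) (Darr D (leg2 B) B)"
    "hequiv_rel K D" "carr D = rel B"
    "\<forall>a b. a \<in> arr K \<longrightarrow> b \<in> arr K \<longrightarrow> src K a = src K b \<longrightarrow> tgt K a = rel B \<longrightarrow> tgt K b = rel B \<longrightarrow>
      (related D a b \<longleftrightarrow> related B (leg1 B \<cdot> a) (leg1 B \<cdot> b) \<and> related B (leg2 B \<cdot> a) (leg2 B \<cdot> b))"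
proof -
  note l = hequiv_rel_legs[OF B]
  define s1 s2 where ss: "s1 = leg1 B" "s2 = leg2 B"
  have s: "s1 \<in> arr K" "src K s1 = rel B" "tgt K s1 = carr B" "s2 \<in> arr K" "src K s2 = rel B"
      "tgt K s2 = carr B" "tup s1 s2 \<in> fib K"
    using l by (simp_all add: ss)
  have o: "carr B \<in> obj K" "rel B \<in> obj K" using hequiv_rel_carr[OF B] src_obj[of s1] s by simp_all
  have sh: "s1 \<in> hom K (rel B) (carr B)" "s2 \<in> hom K (rel B) (carr B)" using s by (simp_all add: hom_def)
  have s12: "related B s1 s2" using related_legs[OF B] by (simp add: ss)
  obtain D where D: "hequiv_rel K D" "carr D = rel B"
    and Drel: "\<And>a b. a \<in> arr K \<Longrightarrow> b \<in> arr K \<Longrightarrow> src K a = src K b \<Longrightarrow> tgt K a = rel B \<Longrightarrow>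
      tgt K b = rel B \<Longrightarrow>
      related D a b \<longleftrightarrow> related B (s1 \<cdot> a) (s1 \<cdot> b) \<and> related B (s2 \<cdot> a) (s2 \<cdot> b)"
    by (rule hequiv_rel_jointly_induced[OF B B sh]) blast
  have s_map: "s1 \<in> ex_maps K D B" "s2 \<in> ex_maps K D B"
  proof -
    have "related B (s1 \<cdot> a) (s1 \<cdot> b) \<and> related B (s2 \<cdot> a) (s2 \<cdot> b)" if ab: "related D a b" for a b
      using Drel[of a b] related_typed[OF D(1) ab] D(2) ab by simp
    then show "s1 \<in> ex_maps K D B" "s2 \<in> ex_maps K D B"
      using sh D B by (simp_all add: ex_maps_iff)
  qed
  have "related B (ident K (carr B)) (ident K (carr B))" using related_refl[OF B] o by simp
  then obtain r where r: "r \<in> arr K" "tgt K r = rel B" "s1 \<cdot> r = ident K (carr B)" "s2 \<cdot> r = ident K (carr B)"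
    by (rule relatedE) (simp add: ss)
  have rs: "src K r = carr B" using r(1-3) s o by (metis cmp_arr(2) ident_arr(2))
  have r_cancel: "s1 \<cdot> (r \<cdot> a) = a" "s2 \<cdot> (r \<cdot> a) = a" if "a \<in> arr K" "tgt K a = carr B" for a
    using cmp_eq_reassoc[OF r(3), of a] cmp_eq_reassoc[OF r(4), of a] that r(1,2) s rs by simp_all
  have r_map: "r \<in> ex_maps K B D"
  proof -
    have "related D (r \<cdot> a) (r \<cdot> b)" if ab: "related B a b" for a b
      using Drel[of "r \<cdot> a" "r \<cdot> b"] related_typed[OF B ab] ab r(1,2) rs by (simp add: r_cancel)
    then show ?thesis using r(1,2) rs D B by (simp add: ex_maps_iff hom_def)
  qed
  have weq: "ex_weak_equivalence K B D r"
    unfolding ex_weak_equivalence_def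
  proof (intro bexI[OF _ s_map(1)] conjI)
    have "related D (r \<cdot> s1) (ident K (rel B))"
      using Drel[of "r \<cdot> s1" "ident K (rel B)"] r(1,2) rs s o related_refl[OF B s(1,3)] s12
      by (simp add: r_cancel)
    then show "(r \<cdot> s1, ident K (carr D)) \<in> ex_sim K D D"
      using cmp_ex_map[OF D(1) B D(1) s_map(1) r_map] ident_ex_map[OF D(1)] D by (simp add: ex_sim_iff)
    show "(s1 \<cdot> r, ident K (carr B)) \<in> ex_sim K B B"
      using ident_ex_map[OF B] related_refl[OF B] o B by (simp add: ex_sim_iff r(3))
  qed
  obtain Q where Q: "prod_rel B B Q" using prod_rel_ex[OF B B] .
  have Q': "hequiv_rel K Q" "carr Q = prd (carr B) (carr B)" using Q by (simp_all add: prod_rel_def)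
  note lQ = hequiv_rel_legs[OF Q'(1), unfolded Q'(2)]
  have u_map: "tup s1 s2 \<in> ex_maps K D Q" by (rule tup_ex_map[OF Q B B D(1) s_map])
  have fib: "ex_fibration K D Q (tup s1 s2)"
  proof -
    obtain V p1 p2 where pb: "pullback K (tup s1 s2) (leg1 Q) V p1 p2"
      using fib_pullback_ex[OF s(7) lQ(1)] s lQ by auto
    have p: "p1 \<in> arr K" "src K p1 = V" "tgt K p1 = rel B" "p2 \<in> arr K" "src K p2 = V" "tgt K p2 = rel Q"
      "tup s1 s2 \<cdot> p1 = leg1 Q \<cdot> p2"
      using pullbackD[OF pb] s lQ by simp_all
    \<comment> \<open>Path lifting: \<open>y1\<close> and \<open>y2\<close> are related to the
      endpoints of \<open>p1\<close>, hence to each other by transitivity. A lift \<open>k\<close>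
      of this pair is the end of the required \<open>d\<close>, which starts at
      \<open>p1\<close>.\<close>
    define y1 y2 where y: "y1 = pr1 (carr B) (carr B) \<cdot> (leg2 Q \<cdot> p2)" "y2 = pr2 (carr B) (carr B) \<cdot> (leg2 Q \<cdot> p2)"
    have yt: "y1 \<in> arr K" "y2 \<in> arr K" "src K y1 = V" "src K y2 = V" "tgt K y1 = carr B" "tgt K y2 = carr B"
      "tup y1 y2 = leg2 Q \<cdot> p2"
      using p lQ o by (simp_all add: y)
    have "related Q (leg1 Q \<cdot> p2) (leg2 Q \<cdot> p2)"
      using related_cmp[OF Q'(1) related_legs[OF Q'(1)]] p lQ by simp
    then have "related Q (tup (s1 \<cdot> p1) (s2 \<cdot> p1)) (leg2 Q \<cdot> p2)" using p s by simp
    from prod_relD[OF Q this] have "related B (s1 \<cdot> p1) y1" "related B (s2 \<cdot> p1) y2"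
      using p s o by (simp_all add: y)
    moreover have "related B (s1 \<cdot> p1) (s2 \<cdot> p1)" using related_cmp[OF B s12] p s by simp
    ultimately have y12: "related B y1 y2" and sy: "related B (s1 \<cdot> p1) y1" "related B (s2 \<cdot> p1) y2"
      using related_trans[OF B] related_sym[OF B] by blast+
    obtain k where k: "k \<in> arr K" "tgt K k = rel B" "s1 \<cdot> k = y1" "s2 \<cdot> k = y2"
      using y12 by (rule relatedE) (simp add: ss)
    have ks: "src K k = V" using k(1-3) s yt by (metis cmp_arr(2))
    have "related D p1 k" using Drel[of p1 k] p k ks sy by simp
    then obtain d where d: "d \<in> arr K" "tgt K d = rel D" "leg1 D \<cdot> d = p1" "leg2 D \<cdot> d = k"
      by (rule relatedE)
    have ds: "src K d = V" using d(1-3) hequiv_rel_legs[OF D(1)] p by (metis cmp_arr(2))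
    have "tup s1 s2 \<cdot> (leg2 D \<cdot> d) = leg2 Q \<cdot> p2" using k ks s yt by (simp add: d(4))
    then show ?thesis
      unfolding ex_fibration_def using s(7) pb d ds by (auto simp: hom_def)
  qed
  have "path_object (Ex_cat K) B D (Darr B r D) (Darr D s1 B) (Darr D s2 B)"
    unfolding path_object_def
  proof (intro conjI)
    show "pair_fibration (Ex_cat K) D B (Darr D s1 B) (Darr D s2 B)"
      unfolding pair_fibration_def
      by (rule exI, rule exI, rule exI, rule exI[of _ "Darr D (tup s1 s2) Q"], rule conjI[OF product_Ex[OF Q B B]])
        (use u_map fib D(1) Q'(1) s in \<open>simp add: hom_Ex Ex_simps\<close>)
  qed (use r_map s_map weq B D(1) D(2) r in \<open>simp_all add: hom_Ex Ex_simps\<close>)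
  then show thesis using that D Drel unfolding ss by blast
qed

text \<open>A homotopy may use any path object, so the forward direction cannot choose one. Its
  reflexivity map has a homotopy inverse \<open>k\<close>, and cancelling shows that both endpoint
  maps are related to \<open>k\<close>, hence to each other. Backwards, the relation of
  \<open>B\<close> is the path object, and a lift of \<open>(f, g)\<close> is tracked because
  \<open>f\<close> and \<open>g\<close> are.\<close>

lemma homotopic_Ex_iff:
  assumes A: "hequiv_rel K A" and B: "hequiv_rel K B"
    and f: "f \<in> ex_maps K A B" and g: "g \<in> ex_maps K A B"
  shows "homotopic (Ex_cat K) (Darr A f B) (Darr A g B) \<longleftrightarrow> related B f g"
proof
  assume "homotopic (Ex_cat K) (Darr A f B) (Darr A g B)"
  then obtain P R S T H where P: "path_object (Ex_cat K) B P R S T"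
    and H: "H \<in> hom (Ex_cat K) A P" "S \<cdot>\<^bsub>Ex_cat K\<^esub> H = Darr A f B" "T \<cdot>\<^bsub>Ex_cat K\<^esub> H = Darr A g B"
    by (auto simp: homotopic_def Ex_simps)
  have hP: "hequiv_rel K P" using P by (simp add: path_object_def hom_Ex)
  obtain r s t where R: "R = Darr B r P" "S = Darr P s B" "T = Darr P t B"
    and r: "r \<in> ex_maps K B P" and st: "s \<in> ex_maps K P B" "t \<in> ex_maps K P B"
    using P unfolding path_object_def hom_Ex by blast
  have sr: "s \<cdot> r = ident K (carr B)" "t \<cdot> r = ident K (carr B)" and "ex_weak_equivalence K B P r"
    using P by (simp_all add: path_object_def R Ex_simps)
  then obtain k where k: "k \<in> ex_maps K P B" and "(r \<cdot> k, ident K (carr P)) \<in> ex_sim K P P"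
    unfolding ex_weak_equivalence_def by blast
  then have rk: "related P (r \<cdot> k) (ident K (carr P))" using hP by (simp add: ex_sim_iff)
  note typed = ex_mapD[OF r] ex_mapD[OF st(1)] ex_mapD[OF st(2)] ex_mapD[OF k]
  have "related B k s" "related B k t"
    using ex_map_related[OF st(1) hP B rk] ex_map_related[OF st(2) hP B rk] typed
      cmp_eq_reassoc[OF sr(1), of k] cmp_eq_reassoc[OF sr(2), of k] by simp_all
  then have st': "related B s t" using related_sym[OF B] related_trans[OF B] by blast
  obtain h where h: "H = Darr A h P" "h \<in> ex_maps K A P" using H(1) unfolding hom_Ex by blast
  have "s \<cdot> h = f" "t \<cdot> h = g" using H(2,3) by (simp_all add: R h Ex_simps)
  then show "related B f g" using related_cmp[OF B st', of h] ex_mapD[OF h(2)] typed by simp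
next
  assume fg: "related B f g"
  obtain D r where P: "path_object (Ex_cat K) B D (Darr B r D) (Darr D (leg1 B) B) (Darr D (leg2 B) B)"
    and D: "hequiv_rel K D" "carr D = rel B"
    and Drel: "\<forall>a b. a \<in> arr K \<longrightarrow> b \<in> arr K \<longrightarrow> src K a = src K b \<longrightarrow> tgt K a = rel B \<longrightarrow> tgt K b = rel B \<longrightarrow>
      (related D a b \<longleftrightarrow> related B (leg1 B \<cdot> a) (leg1 B \<cdot> b) \<and> related B (leg2 B \<cdot> a) (leg2 B \<cdot> b))"
    using rel_path_object[OF B] .
  note l = hequiv_rel_legs[OF B] and f' = ex_mapD[OF f]
  obtain h where h: "h \<in> arr K" "tgt K h = rel B" "leg1 B \<cdot> h = f" "leg2 B \<cdot> h = g"
    using fg by (rule relatedE)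
  have hs: "src K h = carr A" using h(1-3) l f' by (metis cmp_arr(2))
  have "related D (h \<cdot> a) (h \<cdot> b)" if ab: "related A a b" for a b
  proof -
    note abt = related_typed[OF A ab]
    have "leg1 B \<cdot> (h \<cdot> x) = f \<cdot> x" "leg2 B \<cdot> (h \<cdot> x) = g \<cdot> x" if "x \<in> arr K" "tgt K x = carr A" for x
      using cmp_eq_reassoc[OF h(3), of x] cmp_eq_reassoc[OF h(4), of x] h(1,2) hs l that by simp_all
    then show ?thesis
      using Drel[rule_format, of "h \<cdot> a" "h \<cdot> b"] h(1,2) hs abt
        ex_map_related[OF f A B ab] ex_map_related[OF g A B ab] by simp
  qed
  then have "h \<in> ex_maps K A D" using h(1,2) hs A D by (simp add: ex_maps_iff hom_def)
  then have "Darr A h D \<in> hom (Ex_cat K) A D"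
    "Darr D (leg1 B) B \<cdot>\<^bsub>Ex_cat K\<^esub> Darr A h D = Darr A f B"
    "Darr D (leg2 B) B \<cdot>\<^bsub>Ex_cat K\<^esub> Darr A h D = Darr A g B"
    using A D h by (simp_all add: hom_Ex Ex_simps)
  then have "\<exists>h \<in> hom (Ex_cat K) A D. Darr D (leg1 B) B \<cdot>\<^bsub>Ex_cat K\<^esub> h = Darr A f B \<and>
      Darr D (leg2 B) B \<cdot>\<^bsub>Ex_cat K\<^esub> h = Darr A g B" by blast
  with P have "\<exists>P r s t. path_object (Ex_cat K) B P r s t \<and> (\<exists>h \<in> hom (Ex_cat K) A P.
      s \<cdot>\<^bsub>Ex_cat K\<^esub> h = Darr A f B \<and> t \<cdot>\<^bsub>Ex_cat K\<^esub> h = Darr A g B)" by blast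
  then show "homotopic (Ex_cat K) (Darr A f B) (Darr A g B)"
    using A B f g by (simp add: homotopic_def Ex_simps)
qed

end

section \<open>The homotopy category of the exact completion\<close>

context plain_path_category
begin

definition quo :: "('o, 'm) relobj \<Rightarrow> 'm \<Rightarrow> ('o, 'm) relobj \<Rightarrow> (('o, 'm) relobj, 'm set) darr" where
  "quo A f B = Darr A (ex_sim K A B `` {f}) B"

lemma ex_sim_class_eq_iff:
  assumes A: "hequiv_rel K A" and B: "hequiv_rel K B" and f: "f \<in> ex_maps K A B" and g: "g \<in> ex_maps K A B"
  shows "ex_sim K A B `` {f} = ex_sim K A B `` {g} \<longleftrightarrow> related B f g"
proof
  assume "ex_sim K A B `` {f} = ex_sim K A B `` {g}"
  moreover have "(g, g) \<in> ex_sim K A B"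
    using ex_sim_iff[OF A B] g related_refl[OF B ex_mapD(1,3)[OF g]] by simp
  ultimately have "(f, g) \<in> ex_sim K A B" by blast
  then show "related B f g" using ex_sim_iff[OF A B] by simp
next
  assume "related B f g"
  then show "ex_sim K A B `` {f} = ex_sim K A B `` {g}"
    using ex_sim_iff[OF A B] f g related_sym[OF B] related_trans[OF B] unfolding Image_singleton by blast
qed

lemma quo_eq_iff:
  assumes "hequiv_rel K A" "hequiv_rel K B" "f \<in> ex_maps K A B" "g \<in> ex_maps K A B"
  shows "quo A f B = quo A g B \<longleftrightarrow> related B f g"
  using ex_sim_class_eq_iff[OF assms] by (simp add: quo_def)

lemma Hex_simps:
  "obj (Hex_cat K) = {A. hequiv_rel K A}"
  "src (Hex_cat K) = dsrc" "tgt (Hex_cat K) = dtgt"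
  "ident (Hex_cat K) A = quo A (ident K (carr A)) A"
  by (simp_all add: Hex_cat_def Let_def quo_def)

lemma hom_Hex:
  "F \<in> hom (Hex_cat K) A B \<longleftrightarrow> hequiv_rel K A \<and> hequiv_rel K B \<and> (\<exists>f \<in> ex_maps K A B. F = quo A f B)"
  by (auto simp: hom_def Hex_cat_def Let_def quo_def quotient_def)

text \<open>Composition is a union over all pairs of representatives, and it collapses to one class
  because relatedness is a congruence: changing \<open>g\<close> uses stability under
  precomposition, changing \<open>f\<close> uses that \<open>g'\<close> is tracked.\<close>

lemma quo_cmp:
  assumes A: "hequiv_rel K A" and B: "hequiv_rel K B" and D: "hequiv_rel K D"
    and f: "f \<in> ex_maps K A B" and g: "g \<in> ex_maps K B D"
  shows "quo B g D \<cdot>\<^bsub>Hex_cat K\<^esub> quo A f B = quo A (g \<cdot> f) D"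
proof -
  have "ex_sim K A D `` {g' \<cdot> f'} = ex_sim K A D `` {g \<cdot> f}"
    if "(g, g') \<in> ex_sim K B D" "(f, f') \<in> ex_sim K A B" for f' g'
  proof -
    have f': "f' \<in> ex_maps K A B" "related B f f'" and g': "g' \<in> ex_maps K B D" "related D g g'"
      using that ex_sim_iff A B D by simp_all
    have "related D (g \<cdot> f) (g' \<cdot> f)"
      using related_cmp[OF D g'(2), of f] ex_mapD[OF f] ex_mapD[OF g] by simp
    moreover have "related D (g' \<cdot> f) (g' \<cdot> f')" by (rule ex_map_related[OF g'(1) B D f'(2)])
    ultimately have "related D (g' \<cdot> f') (g \<cdot> f)" using related_sym[OF D] related_trans[OF D] by blast
    then show ?thesis
      using ex_sim_class_eq_iff[OF A D cmp_ex_map[OF A B D f'(1) g'(1)] cmp_ex_map[OF A B D f g]] by simp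
  qed
  moreover have "(g, g) \<in> ex_sim K B D" "(f, f) \<in> ex_sim K A B"
    using ex_sim_iff A B D f g related_refl[OF B ex_mapD(1,3)[OF f]] related_refl[OF D ex_mapD(1,3)[OF g]]
    by simp_all
  ultimately have "(\<Union>g' \<in> ex_sim K B D `` {g}. \<Union>f' \<in> ex_sim K A B `` {f}. ex_sim K A D `` {g' \<cdot> f'}) =
      ex_sim K A D `` {g \<cdot> f}" by blast
  then show ?thesis by (simp add: Hex_cat_def Let_def quo_def)
qed

lemma category_Hex: "category (Hex_cat K)"
proof
  show "src (Hex_cat K) F \<in> obj (Hex_cat K)" "tgt (Hex_cat K) F \<in> obj (Hex_cat K)"
    if "F \<in> arr (Hex_cat K)" for F
    using that by (auto simp: Hex_cat_def Let_def)
  show "ident (Hex_cat K) A \<in> hom (Hex_cat K) A A" if "A \<in> obj (Hex_cat K)" for A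
    using that ident_ex_map by (auto simp: hom_Hex Hex_simps)
  show "G \<cdot>\<^bsub>Hex_cat K\<^esub> F \<in> hom (Hex_cat K) A C"
    if F: "F \<in> hom (Hex_cat K) A B" and G: "G \<in> hom (Hex_cat K) B C" for F G A B C
  proof -
    obtain f g where "F = quo A f B" "f \<in> ex_maps K A B" "G = quo B g C" "g \<in> ex_maps K B C"
      and ABC: "hequiv_rel K A" "hequiv_rel K B" "hequiv_rel K C"
      using F G unfolding hom_Hex by blast
    then show ?thesis using cmp_ex_map[OF ABC] quo_cmp[OF ABC] unfolding hom_Hex by blast
  qed
  show "ident (Hex_cat K) B \<cdot>\<^bsub>Hex_cat K\<^esub> F = F" "F \<cdot>\<^bsub>Hex_cat K\<^esub> ident (Hex_cat K) A = F"
    if F: "F \<in> hom (Hex_cat K) A B" for F A B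
  proof -
    obtain f where f: "F = quo A f B" "f \<in> ex_maps K A B" and AB: "hequiv_rel K A" "hequiv_rel K B"
      using F unfolding hom_Hex by blast
    show "ident (Hex_cat K) B \<cdot>\<^bsub>Hex_cat K\<^esub> F = F"
      using quo_cmp[OF AB AB(2) f(2) ident_ex_map[OF AB(2)]] ex_mapD[OF f(2)] by (simp add: f(1) Hex_simps)
    show "F \<cdot>\<^bsub>Hex_cat K\<^esub> ident (Hex_cat K) A = F"
      using quo_cmp[OF AB(1) AB ident_ex_map[OF AB(1)] f(2)] ex_mapD[OF f(2)] by (simp add: f(1) Hex_simps)
  qed
  show "H \<cdot>\<^bsub>Hex_cat K\<^esub> (G \<cdot>\<^bsub>Hex_cat K\<^esub> F) = (H \<cdot>\<^bsub>Hex_cat K\<^esub> G) \<cdot>\<^bsub>Hex_cat K\<^esub> F"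
    if F: "F \<in> hom (Hex_cat K) A B" and G: "G \<in> hom (Hex_cat K) B C" and H: "H \<in> hom (Hex_cat K) C D"
    for F G H A B C D
  proof -
    obtain f g h where FGH: "F = quo A f B" "G = quo B g C" "H = quo C h D"
      and f: "f \<in> ex_maps K A B" and g: "g \<in> ex_maps K B C" and h: "h \<in> ex_maps K C D"
      and o: "hequiv_rel K A" "hequiv_rel K B" "hequiv_rel K C" "hequiv_rel K D"
      using F G H unfolding hom_Hex by blast
    show ?thesis
      using cmp_ex_map[OF o(1,2,3) f g] cmp_ex_map[OF o(2,3,4) g h] ex_mapD[OF f] ex_mapD[OF g] ex_mapD[OF h]
        quo_cmp[OF o(1,2,3) f g] quo_cmp[OF o(2,3,4) g h]
      by (simp add: FGH quo_cmp o f h)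
  qed
qed

text \<open>Passing to classes keeps the product because relatedness in \<open>D\<close> is
  componentwise: the classes of its two components determine the class of a mediating map.\<close>

lemma product_Hex:
  assumes D: "prod_rel A B D" and A: "hequiv_rel K A" and B: "hequiv_rel K B"
  shows "product (Hex_cat K) A B D (quo D (pr1 (carr A) (carr B)) A) (quo D (pr2 (carr A) (carr B)) B)"
  unfolding product_def
proof (intro conjI allI impI)
  note pr = prod_rel_pr_ex_maps[OF D A B]
  have D': "hequiv_rel K D" using D by (simp add: prod_rel_def)
  show "quo D (pr1 (carr A) (carr B)) A \<in> hom (Hex_cat K) D A"
    "quo D (pr2 (carr A) (carr B)) B \<in> hom (Hex_cat K) D B"
    using pr D' A B unfolding hom_Hex by blast+
  fix Z F G assume "F \<in> hom (Hex_cat K) Z A" "G \<in> hom (Hex_cat K) Z B"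
  then obtain f g where F: "F = quo Z f A" and G: "G = quo Z g B" and Z: "hequiv_rel K Z"
    and f: "f \<in> ex_maps K Z A" and g: "g \<in> ex_maps K Z B" unfolding hom_Hex by blast
  note f' = ex_mapD[OF f] and g' = ex_mapD[OF g]
  have t: "tup f g \<in> ex_maps K Z D" by (rule tup_ex_map[OF D A B Z f g])
  have iff: "quo D (pr1 (carr A) (carr B)) A \<cdot>\<^bsub>Hex_cat K\<^esub> quo Z u D = F \<and>
      quo D (pr2 (carr A) (carr B)) B \<cdot>\<^bsub>Hex_cat K\<^esub> quo Z u D = G \<longleftrightarrow> quo Z u D = quo Z (tup f g) D"
    if u: "u \<in> ex_maps K Z D" for u
    unfolding quo_cmp[OF Z D' A u pr(1)] quo_cmp[OF Z D' B u pr(2)] F G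
      quo_eq_iff[OF Z A cmp_ex_map[OF Z D' A u pr(1)] f] quo_eq_iff[OF Z B cmp_ex_map[OF Z D' B u pr(2)] g]
      quo_eq_iff[OF Z D' u t] related_prod_rel_iff[OF D u t]
    using f' g' by simp
  show "\<exists>!U. U \<in> hom (Hex_cat K) Z D \<and> quo D (pr1 (carr A) (carr B)) A \<cdot>\<^bsub>Hex_cat K\<^esub> U = F \<and>
      quo D (pr2 (carr A) (carr B)) B \<cdot>\<^bsub>Hex_cat K\<^esub> U = G"
  proof (rule ex1I[of _ "quo Z (tup f g) D"])
    show "quo Z (tup f g) D \<in> hom (Hex_cat K) Z D \<and>
      quo D (pr1 (carr A) (carr B)) A \<cdot>\<^bsub>Hex_cat K\<^esub> quo Z (tup f g) D = F \<and>
      quo D (pr2 (carr A) (carr B)) B \<cdot>\<^bsub>Hex_cat K\<^esub> quo Z (tup f g) D = G"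
      using t Z D' iff[OF t] unfolding hom_Hex by blast
    fix U assume U: "U \<in> hom (Hex_cat K) Z D \<and> quo D (pr1 (carr A) (carr B)) A \<cdot>\<^bsub>Hex_cat K\<^esub> U = F \<and>
      quo D (pr2 (carr A) (carr B)) B \<cdot>\<^bsub>Hex_cat K\<^esub> U = G"
    then obtain u where "U = quo Z u D" "u \<in> ex_maps K Z D" unfolding hom_Hex by blast
    then show "U = quo Z (tup f g) D" using iff U by blast
  qed
qed

end


section \<open>Exponentials\<close>

context weak_Pi_path_category
begin

lemma has_homotopy_exponentials_Ex: "has_homotopy_exponentials (Ex_cat K)"
  unfolding has_homotopy_exponentials_def has_binary_products_def
proof (intro conjI ballI)
  show "\<exists>P p q. product (Ex_cat K) X Y P p q" if "X \<in> obj (Ex_cat K)" "Y \<in> obj (Ex_cat K)" for X Y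
  proof -
    have XY: "hequiv_rel K X" "hequiv_rel K Y" using that by (simp_all add: Ex_simps)
    obtain D where "prod_rel X Y D" using prod_rel_ex[OF XY] .
    from product_Ex[OF this XY] show ?thesis by blast
  qed
  fix X Y assume "X \<in> obj (Ex_cat K)" "Y \<in> obj (Ex_cat K)"
  then have X: "hequiv_rel K X" and Y: "hequiv_rel K Y" by (simp_all add: Ex_simps)
  obtain E D ev where E: "hequiv_rel K E" and D: "prod_rel E Y D" and ev: "ev \<in> ex_maps K D X"
    and curry: "\<forall>A Q h. hequiv_rel K A \<longrightarrow> prod_rel A Y Q \<longrightarrow> h \<in> ex_maps K Q X \<longrightarrow>
      (\<exists>H \<in> ex_maps K A E. related X (ev \<cdot> times_id (carr Y) H) h)"
    and curry_unique: "\<forall>H H' Z. H \<in> hom K Z (carr E) \<longrightarrow> H' \<in> hom K Z (carr E) \<longrightarrow>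
      related X (ev \<cdot> times_id (carr Y) H) (ev \<cdot> times_id (carr Y) H') \<longrightarrow> related E H H'"
    using exponential_relation[OF X Y] .
  have D': "hequiv_rel K D" using D by (simp add: prod_rel_def)
  let ?p1 = "Darr D (pr1 (carr E) (carr Y)) E" and ?p2 = "Darr D (pr2 (carr E) (carr Y)) Y"
  have "homotopy_exponential (Ex_cat K) X Y E D ?p1 ?p2 (Darr D ev X)"
  proof (rule homotopy_exponentialI[OF category_Ex _ product_Ex[OF D E Y]])
    show "E \<in> obj (Ex_cat K)" using E by (simp add: Ex_simps)
    show "Darr D ev X \<in> hom (Ex_cat K) D X" using ev D' X by (simp add: hom_Ex)
    fix A assume "A \<in> obj (Ex_cat K)"
    then have A: "hequiv_rel K A" by (simp add: Ex_simps)
    obtain Q where Q: "prod_rel A Y Q" using prod_rel_ex[OF A Y] .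
    have Q': "hequiv_rel K Q" using Q by (simp add: prod_rel_def)
    let ?q1 = "Darr Q (pr1 (carr A) (carr Y)) A" and ?q2 = "Darr Q (pr2 (carr A) (carr Y)) Y"
    let ?curry = "\<lambda>h H. H \<in> hom (Ex_cat K) A E \<and>
      (\<exists>u. is_times_id (Ex_cat K) Q ?q1 ?q2 D ?p1 ?p2 H u \<and>
        homotopic (Ex_cat K) (Darr D ev X \<cdot>\<^bsub>Ex_cat K\<^esub> u) h)"
    \<comment> \<open>Products in the exact completion are strict, so
      \<open>times_id (carr Y) H\<close> is the only candidate for \<open>H \<times> 1\<close>, and
      being a currying becomes a single statement about relatedness.\<close>
    have iff: "?curry (Darr Q h X) (Darr A H E) \<longleftrightarrow> related X (ev \<cdot> times_id (carr Y) H) h"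
      if H: "H \<in> ex_maps K A E" and h: "h \<in> ex_maps K Q X" for H h
    proof -
      note t = times_id_ex_map[OF Q D A E Y H]
      note ce = cmp_ex_map[OF Q' D' X t ev]
      have "is_times_id (Ex_cat K) Q ?q1 ?q2 D ?p1 ?p2 (Darr A H E) u \<longleftrightarrow>
          u = Darr Q (times_id (carr Y) H) D" for u
      proof
        assume "is_times_id (Ex_cat K) Q ?q1 ?q2 D ?p1 ?p2 (Darr A H E) u"
        then obtain v where v: "v \<in> ex_maps K Q D" "u = Darr Q v D"
          "pr1 (carr E) (carr Y) \<cdot> v = H \<cdot> pr1 (carr A) (carr Y)"
          "pr2 (carr E) (carr Y) \<cdot> v = pr2 (carr A) (carr Y)"
          by (auto simp: is_times_id_def hom_Ex Ex_simps)
        have "tup (pr1 (carr E) (carr Y) \<cdot> v) (pr2 (carr E) (carr Y) \<cdot> v) = v"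
          by (rule tup_eta) (use ex_mapD[OF v(1)] D E Y hequiv_rel_carr in \<open>simp_all add: prod_rel_def\<close>)
        then show "u = Darr Q (times_id (carr Y) H) D" by (simp add: v(2,3,4) ex_mapD[OF H])
      next
        assume u: "u = Darr Q (times_id (carr Y) H) D"
        show "is_times_id (Ex_cat K) Q ?q1 ?q2 D ?p1 ?p2 (Darr A H E) u"
          unfolding is_times_id_def u
          using t Q' D' ex_mapD[OF H] hequiv_rel_carr[OF A] hequiv_rel_carr[OF Y]
          by (simp add: hom_Ex Ex_simps)
      qed
      then show ?thesis
        using H A E homotopic_Ex_iff[OF Q' X ce h] by (simp add: hom_Ex Ex_simps)
    qed
    have main: "\<forall>h \<in> hom (Ex_cat K) Q X. (\<exists>H. ?curry h H) \<and>
      (\<forall>H H'. ?curry h H \<longrightarrow> ?curry h H' \<longrightarrow> homotopic (Ex_cat K) H H')"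
    proof (rule ballI, intro conjI allI impI)
      fix F assume "F \<in> hom (Ex_cat K) Q X"
      then obtain h where F: "F = Darr Q h X" and h: "h \<in> ex_maps K Q X" unfolding hom_Ex by blast
      show "\<exists>H. ?curry F H" unfolding F using curry[rule_format, OF A Q h] iff[OF _ h] by blast
      fix G G' assume G: "?curry F G" and G': "?curry F G'"
      then have "G \<in> hom (Ex_cat K) A E" "G' \<in> hom (Ex_cat K) A E" by blast+
      then obtain H H' where H: "G = Darr A H E" "G' = Darr A H' E" "H \<in> ex_maps K A E" "H' \<in> ex_maps K A E"
        unfolding hom_Ex by blast
      have "related X (ev \<cdot> times_id (carr Y) H) h" "related X (ev \<cdot> times_id (carr Y) H') h"
        using G iff[OF H(3) h] G' iff[OF H(4) h] unfolding H(1,2) F by blast+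
      then have "related X (ev \<cdot> times_id (carr Y) H) (ev \<cdot> times_id (carr Y) H')"
        using related_sym[OF X] related_trans[OF X] by blast
      moreover have "H \<in> hom K (carr A) (carr E)" "H' \<in> hom K (carr A) (carr E)"
        using ex_mapD[OF H(3)] ex_mapD[OF H(4)] by (simp_all add: hom_def)
      ultimately have "related E H H'" using curry_unique by blast
      then show "homotopic (Ex_cat K) G G'" using homotopic_Ex_iff[OF A E H(3,4)] by (simp add: H(1,2))
    qed
    show "\<exists>Q q1 q2. product (Ex_cat K) A Y Q q1 q2 \<and> (\<forall>h \<in> hom (Ex_cat K) Q X.
      (\<exists>H. H \<in> hom (Ex_cat K) A E \<and> (\<exists>u. is_times_id (Ex_cat K) Q q1 q2 D ?p1 ?p2 H u \<and>
        homotopic (Ex_cat K) (Darr D ev X \<cdot>\<^bsub>Ex_cat K\<^esub> u) h)) \<and>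
      (\<forall>H H'. H \<in> hom (Ex_cat K) A E \<and> (\<exists>u. is_times_id (Ex_cat K) Q q1 q2 D ?p1 ?p2 H u \<and>
          homotopic (Ex_cat K) (Darr D ev X \<cdot>\<^bsub>Ex_cat K\<^esub> u) h) \<longrightarrow>
        H' \<in> hom (Ex_cat K) A E \<and> (\<exists>u. is_times_id (Ex_cat K) Q q1 q2 D ?p1 ?p2 H' u \<and>
          homotopic (Ex_cat K) (Darr D ev X \<cdot>\<^bsub>Ex_cat K\<^esub> u) h) \<longrightarrow>
        homotopic (Ex_cat K) H H'))"
      by (rule exI, rule exI, rule exI, rule conjI[OF product_Ex[OF Q A Y]], rule main)
  qed
  then show "\<exists>E P p1 p2 ev. homotopy_exponential (Ex_cat K) X Y E P p1 p2 ev" by blast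
qed

lemma has_exponentials_Hex: "has_exponentials (Hex_cat K)"
  unfolding has_exponentials_def has_binary_products_def
proof (intro conjI ballI)
  interpret Hex: category "Hex_cat K" by (rule category_Hex)
  show "\<exists>P p q. product (Hex_cat K) X Y P p q" if "X \<in> obj (Hex_cat K)" "Y \<in> obj (Hex_cat K)" for X Y
  proof -
    have XY: "hequiv_rel K X" "hequiv_rel K Y" using that by (simp_all add: Hex_simps)
    obtain D where "prod_rel X Y D" using prod_rel_ex[OF XY] .
    from product_Hex[OF this XY] show ?thesis by blast
  qed
  fix X Y assume "X \<in> obj (Hex_cat K)" "Y \<in> obj (Hex_cat K)"
  then have X: "hequiv_rel K X" and Y: "hequiv_rel K Y" by (simp_all add: Hex_simps)
  obtain E D ev where E: "hequiv_rel K E" and D: "prod_rel E Y D" and ev: "ev \<in> ex_maps K D X"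
    and curry: "\<forall>A Q h. hequiv_rel K A \<longrightarrow> prod_rel A Y Q \<longrightarrow> h \<in> ex_maps K Q X \<longrightarrow>
      (\<exists>H \<in> ex_maps K A E. related X (ev \<cdot> times_id (carr Y) H) h)"
    and curry_unique: "\<forall>H H' Z. H \<in> hom K Z (carr E) \<longrightarrow> H' \<in> hom K Z (carr E) \<longrightarrow>
      related X (ev \<cdot> times_id (carr Y) H) (ev \<cdot> times_id (carr Y) H') \<longrightarrow> related E H H'"
    using exponential_relation[OF X Y] .
  have D': "hequiv_rel K D" using D by (simp add: prod_rel_def)
  let ?p1 = "quo D (pr1 (carr E) (carr Y)) E" and ?p2 = "quo D (pr2 (carr E) (carr Y)) Y"
  note p = prod_rel_pr_ex_maps[OF D E Y]
  have "exponential (Hex_cat K) X Y E D ?p1 ?p2 (quo D ev X)"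
  proof (rule Hex.exponentialI[OF _ product_Hex[OF D E Y]])
    show "E \<in> obj (Hex_cat K)" using E by (simp add: Hex_simps)
    show "quo D ev X \<in> hom (Hex_cat K) D X" using ev D' X unfolding hom_Hex by blast
    fix A assume "A \<in> obj (Hex_cat K)"
    then have A: "hequiv_rel K A" by (simp add: Hex_simps)
    obtain Q where Q: "prod_rel A Y Q" using prod_rel_ex[OF A Y] .
    have Q': "hequiv_rel K Q" using Q by (simp add: prod_rel_def)
    note q = prod_rel_pr_ex_maps[OF Q A Y]
    let ?q1 = "quo Q (pr1 (carr A) (carr Y)) A" and ?q2 = "quo Q (pr2 (carr A) (carr Y)) Y"
    let ?curry = "\<lambda>h H. H \<in> hom (Hex_cat K) A E \<and>
      (\<exists>u. is_times_id (Hex_cat K) Q ?q1 ?q2 D ?p1 ?p2 H u \<and> quo D ev X \<cdot>\<^bsub>Hex_cat K\<^esub> u = h)"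
    \<comment> \<open>Now \<open>H \<times> 1\<close> is determined as a class only; componentwise
      relatedness in \<open>D\<close> identifies it as the class of
      \<open>times_id (carr Y) H\<close>.\<close>
    have iff: "?curry (quo Q h X) (quo A H E) \<longleftrightarrow> related X (ev \<cdot> times_id (carr Y) H) h"
      if H: "H \<in> ex_maps K A E" and h: "h \<in> ex_maps K Q X" for H h
    proof -
      note t = times_id_ex_map[OF Q D A E Y H]
      note ce = cmp_ex_map[OF Q' D' X t ev]
      have pt: "pr1 (carr E) (carr Y) \<cdot> times_id (carr Y) H = H \<cdot> pr1 (carr A) (carr Y)"
        "pr2 (carr E) (carr Y) \<cdot> times_id (carr Y) H = pr2 (carr A) (carr Y)"
        using ex_mapD[OF H] hequiv_rel_carr[OF A] hequiv_rel_carr[OF Y] by simp_all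
      have times: "is_times_id (Hex_cat K) Q ?q1 ?q2 D ?p1 ?p2 (quo A H E) u \<longleftrightarrow>
          u = quo Q (times_id (carr Y) H) D" for u
      proof -
        have "?p1 \<cdot>\<^bsub>Hex_cat K\<^esub> quo Q v D = quo A H E \<cdot>\<^bsub>Hex_cat K\<^esub> ?q1 \<and> ?p2 \<cdot>\<^bsub>Hex_cat K\<^esub> quo Q v D = ?q2 \<longleftrightarrow>
            quo Q v D = quo Q (times_id (carr Y) H) D" if v: "v \<in> ex_maps K Q D" for v
          unfolding quo_cmp[OF Q' D' E v p(1)] quo_cmp[OF Q' D' Y v p(2)] quo_cmp[OF Q' A E q(1) H]
            quo_eq_iff[OF Q' E cmp_ex_map[OF Q' D' E v p(1)] cmp_ex_map[OF Q' A E q(1) H]]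
            quo_eq_iff[OF Q' Y cmp_ex_map[OF Q' D' Y v p(2)] q(2)]
            quo_eq_iff[OF Q' D' v t] related_prod_rel_iff[OF D v t] pt ..
        then show ?thesis using t Q' D' unfolding is_times_id_def hom_Hex by blast
      qed
      have "quo A H E \<in> hom (Hex_cat K) A E" using H A E unfolding hom_Hex by blast
      then show ?thesis
        unfolding times using quo_cmp[OF Q' D' X t ev] quo_eq_iff[OF Q' X ce h] by simp
    qed
    have main: "\<forall>h \<in> hom (Hex_cat K) Q X. \<exists>!H. ?curry h H"
    proof (rule ballI, rule ex_ex1I)
      fix F assume "F \<in> hom (Hex_cat K) Q X"
      then obtain h where F: "F = quo Q h X" and h: "h \<in> ex_maps K Q X" unfolding hom_Hex by blast
      show "\<exists>H. ?curry F H" unfolding F using curry[rule_format, OF A Q h] iff[OF _ h] by blast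
      fix G G' assume G: "?curry F G" and G': "?curry F G'"
      then have "G \<in> hom (Hex_cat K) A E" "G' \<in> hom (Hex_cat K) A E" by blast+
      then obtain H H' where H: "G = quo A H E" "G' = quo A H' E" "H \<in> ex_maps K A E" "H' \<in> ex_maps K A E"
        unfolding hom_Hex by blast
      have "related X (ev \<cdot> times_id (carr Y) H) h" "related X (ev \<cdot> times_id (carr Y) H') h"
        using G iff[OF H(3) h] G' iff[OF H(4) h] unfolding H(1,2) F by blast+
      then have "related X (ev \<cdot> times_id (carr Y) H) (ev \<cdot> times_id (carr Y) H')"
        using related_sym[OF X] related_trans[OF X] by blast
      moreover have "H \<in> hom K (carr A) (carr E)" "H' \<in> hom K (carr A) (carr E)"
        using ex_mapD[OF H(3)] ex_mapD[OF H(4)] by (simp_all add: hom_def)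
      ultimately have "related E H H'" using curry_unique by blast
      then show "G = G'" using quo_eq_iff[OF A E H(3,4)] by (simp add: H(1,2))
    qed
    show "\<exists>Q q1 q2. product (Hex_cat K) A Y Q q1 q2 \<and> (\<forall>h \<in> hom (Hex_cat K) Q X.
      \<exists>!H. H \<in> hom (Hex_cat K) A E \<and>
        (\<exists>u. is_times_id (Hex_cat K) Q q1 q2 D ?p1 ?p2 H u \<and> quo D ev X \<cdot>\<^bsub>Hex_cat K\<^esub> u = h))"
      by (rule exI, rule exI, rule exI, rule conjI[OF product_Hex[OF Q A Y]], rule main)
  qed
  then show "\<exists>E P p1 p2 ev. exponential (Hex_cat K) X Y E P p1 p2 ev" by blast
qed

end

theorem proposition5p9:
  fixes C :: "('o, 'm) pcat"
  assumes "path_category C"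
    and "has_weak_homotopy_Pi C"
  shows "has_homotopy_exponentials (Ex_cat C) \<and> has_exponentials (Hex_cat C)"
proof -
  interpret weak_Pi_path_category C
    using assms by (simp add: weak_Pi_path_category_def plain_path_category_def
        weak_Pi_path_category_axioms_def)
  show ?thesis using has_homotopy_exponentials_Ex has_exponentials_Hex by blast
qed

end
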